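(* Let $C_1,C_2\subset\mathbb{P}^3$ be smooth complex conics spanning different planes. Then the edge curve $E\subset C_1\times C_2\cong\mathbb{P}^1\times\mathbb{P}^1$ has bidegree $(2,2)$.
   Context: Here $\mathbb{P}^3=\mathbb{CP}^3$. A stationary bisecant of $C_1,C_2$ is a line $\overline{p,q}$ spanned by points $p\in C_1$ and $q\in C_2$ with $p\neq q$ such that the tangent lines $T_pC_1$ and $T_qC_2$ meet. The edge curve $E$ is the Zariski closure in $C_1\times C_2$ of the set of pairs $(p,q)$ with $p\neq q$ such that $\overline{p,q}$ is a stationary bisecant. As a smooth conic is isomorphic to $\mathbb{P}^1$, $E$ is regarded as a curve in $\mathbb{P}^1\times\mathbb{P}^1$. A curve in $\mathbb{P}^1\times\mathbb{P}^1$ has bidegree $(a,b)$ if it meets $\mathbb{P}^1\times\{q\}$ in $a$ points for general $q$ and meets $\{p\}\times\mathbb{P}^1$ in $b$ points for general $p$; equivalently, it is defined in homogeneous coordinates $([s:t],[u:v])$ by a bihomogeneous polynomial of degree $a$ in $s,t$ and degree $b$ in $u,v$. *)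

theory Defs
  imports "HOL-Analysis.Analysis"
begin

text \<open>
  Complex projective space. The type \<open>'n proj\<close> has dimension \<open>CARD('n) - 1\<close>; thus the projective
  line is \<open>2 proj\<close> and projective 3-space is \<open>4 proj\<close>. The map \<open>rep_proj\<close> chooses homogeneous
  coordinates, and \<open>abs_proj v\<close> is the point with homogeneous coordinates \<open>v\<close>; it is unspecified
  for \<open>v = 0\<close>.
\<close>

definition proj_rel :: "complex ^ 'n \<Rightarrow> complex ^ 'n \<Rightarrow> bool" where
  "proj_rel v w \<longleftrightarrow> v \<noteq> 0 \<and> w \<noteq> 0 \<and> (\<exists>c. c \<noteq> 0 \<and> w = c *s v)"

lemma part_equivp_proj_rel: "part_equivp (proj_rel :: complex ^ 'n \<Rightarrow> _)"
proof (rule part_equivpI)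
  have "proj_rel (1 :: complex ^ 'n) 1"
    unfolding proj_rel_def by (auto intro!: exI[of _ 1])
  then show "\<exists>v :: complex ^ 'n. proj_rel v v" by blast
  show "symp (proj_rel :: complex ^ 'n \<Rightarrow> _)"
  proof (rule sympI)
    fix v w :: "complex ^ 'n"
    assume "proj_rel v w"
    then obtain c where c: "v \<noteq> 0" "w \<noteq> 0" "c \<noteq> 0" "w = c *s v"
      unfolding proj_rel_def by blast
    then have "v = inverse c *s w" by (simp add: vector_smult_assoc)
    with c show "proj_rel w v" unfolding proj_rel_def by (metis inverse_nonzero_iff_nonzero)
  qed
  show "transp (proj_rel :: complex ^ 'n \<Rightarrow> _)"
    by (rule transpI) (auto simp: proj_rel_def vector_smult_assoc)
qed

quotient_type 'n proj = "complex ^ 'n" / partial: proj_rel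
  by (rule part_equivp_proj_rel)

text \<open>
  Homogeneous polynomials are represented by the functions they define, which is faithful since
  the field is infinite. Whether a form vanishes at a projective point does not depend on the
  choice of homogeneous coordinates.
\<close>

definition exponents :: "nat \<Rightarrow> ('n::finite \<Rightarrow> nat) set" where
  "exponents d = {m. (\<Sum>i\<in>UNIV. m i) = d}"

definition monomial :: "('n::finite \<Rightarrow> nat) \<Rightarrow> complex ^ 'n \<Rightarrow> complex" where
  "monomial m v = (\<Prod>i\<in>UNIV. v $ i ^ m i)"

definition form :: "nat \<Rightarrow> (complex ^ 'n \<Rightarrow> complex) \<Rightarrow> bool" where
  "form d F \<longleftrightarrow> (\<exists>c. F = (\<lambda>v. \<Sum>m\<in>exponents d. c m * monomial m v))"

definition biform :: "nat \<Rightarrow> nat \<Rightarrow> (complex ^ 'm \<Rightarrow> complex ^ 'n \<Rightarrow> complex) \<Rightarrow> bool" where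
  "biform d e F \<longleftrightarrow> (\<exists>c. F = (\<lambda>v w. \<Sum>m\<in>exponents d. \<Sum>n\<in>exponents e.
      c m n * monomial m v * monomial n w))"

definition zero_at :: "(complex ^ 'n \<Rightarrow> complex) \<Rightarrow> 'n proj \<Rightarrow> bool" where
  "zero_at F p \<longleftrightarrow> F (rep_proj p) = 0"

definition bizeros :: "(complex ^ 'm \<Rightarrow> complex ^ 'n \<Rightarrow> complex) \<Rightarrow> ('m proj \<times> 'n proj) set" where
  "bizeros F = {(p, q). F (rep_proj p) (rep_proj q) = 0}"

definition zariski_closure :: "('m::finite proj \<times> 'n::finite proj) set \<Rightarrow> ('m proj \<times> 'n proj) set" where
  "zariski_closure S = \<Inter>{bizeros F | F d e. biform d e F \<and> S \<subseteq> bizeros F}"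

definition differential :: "(complex ^ 'n \<Rightarrow> complex) \<Rightarrow> complex ^ 'n \<Rightarrow> complex ^ 'n \<Rightarrow> complex" where
  "differential F v w = deriv (\<lambda>t. F (v + t *s w)) 0"

text \<open>The embedded projective tangent space, cut out by the differentials at \<open>p\<close> of all forms in
  the homogeneous ideal of \<open>X\<close>.\<close>

definition tangent_space :: "'n::finite proj set \<Rightarrow> 'n proj \<Rightarrow> 'n proj set" where
  "tangent_space X p = {y. \<forall>d F. form d F \<and> (\<forall>x\<in>X. zero_at F x) \<longrightarrow>
      differential F (rep_proj p) (rep_proj y) = 0}"

text \<open>A smooth conic is cut out by a linear form \<open>h\<close> and a quadratic form \<open>Q\<close> whose differentials
  are linearly independent at every common zero (the Jacobian criterion for the scheme
  \<open>h = Q = 0\<close>). In particular \<open>h \<noteq> 0\<close>, \<open>Q\<close> is not identically zero on the plane \<open>h = 0\<close>, and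
  double lines and pairs of lines are excluded.\<close>

definition smooth_conic :: "4 proj set \<Rightarrow> bool" where
  "smooth_conic C \<longleftrightarrow> (\<exists>h Q. form 1 h \<and> form 2 Q \<and> C = {p. zero_at h p \<and> zero_at Q p} \<and>
     (\<forall>p\<in>C. \<forall>a b. (\<forall>w. a * differential h (rep_proj p) w + b * differential Q (rep_proj p) w = 0)
        \<longrightarrow> a = 0 \<and> b = 0))"

text \<open>The linear span of a projective set, as a linear subspace of the space of homogeneous
  coordinates.\<close>

definition linear_span :: "'n proj set \<Rightarrow> (complex ^ 'n) set" where
  "linear_span X = vec.span (rep_proj ` X)"

text \<open>The line spanned by \<open>p\<close> and \<open>q\<close> is a stationary bisecant.\<close>

definition stationary_bisecant :: "4 proj set \<Rightarrow> 4 proj set \<Rightarrow> 4 proj \<Rightarrow> 4 proj \<Rightarrow> bool" where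
  "stationary_bisecant C\<^sub>1 C\<^sub>2 p q \<longleftrightarrow> p \<in> C\<^sub>1 \<and> q \<in> C\<^sub>2 \<and> p \<noteq> q \<and>
     tangent_space C\<^sub>1 p \<inter> tangent_space C\<^sub>2 q \<noteq> {}"

definition edge_curve :: "4 proj set \<Rightarrow> 4 proj set \<Rightarrow> (4 proj \<times> 4 proj) set" where
  "edge_curve C\<^sub>1 C\<^sub>2 = (C\<^sub>1 \<times> C\<^sub>2) \<inter> zariski_closure {(p, q). stationary_bisecant C\<^sub>1 C\<^sub>2 p q}"

text \<open>Near each point of \<open>X\<close>, namely on a basic open set \<open>G \<noteq> 0\<close>, a regular map is given by
  forms of equal degree without common zero.\<close>

definition regular_on :: "'m::finite proj set \<Rightarrow> ('m proj \<Rightarrow> 'n::finite proj) \<Rightarrow> bool" where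
  "regular_on X f \<longleftrightarrow> (\<forall>x\<in>X. \<exists>e G d (F :: complex ^ 'm \<Rightarrow> complex ^ 'n).
     form e G \<and> (\<forall>i. form d (\<lambda>v. F v $ i)) \<and> \<not> zero_at G x \<and>
     (\<forall>y\<in>X. \<not> zero_at G y \<longrightarrow> F (rep_proj y) \<noteq> 0 \<and> f y = abs_proj (F (rep_proj y))))"

definition isomorphism :: "'m::finite proj set \<Rightarrow> 'n::finite proj set \<Rightarrow> ('m proj \<Rightarrow> 'n proj) \<Rightarrow> bool" where
  "isomorphism X Y f \<longleftrightarrow> bij_betw f X Y \<and> regular_on X f \<and> regular_on Y (inv_into X f)"

text \<open>A curve of bidegree \<open>(a, b)\<close> is the zero locus of a form of bidegree \<open>(a, b)\<close> and meets the
  general fibres in \<open>a\<close> and \<open>b\<close> points, respectively. The form by itself would not determine the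
  bidegree, since it might have multiple factors; the point counts force it to be reduced.
  General means all but finitely many, as the nonempty open subsets of the projective line are
  the cofinite ones.\<close>

definition has_bidegree :: "(2 proj \<times> 2 proj) set \<Rightarrow> nat \<Rightarrow> nat \<Rightarrow> bool" where
  "has_bidegree E a b \<longleftrightarrow>
     (\<exists>F. biform a b F \<and> (\<exists>v w. F v w \<noteq> 0) \<and> E = bizeros F) \<and>
     (\<forall>\<^sub>\<infinity>q. card {p. (p, q) \<in> E} = a) \<and>
     (\<forall>\<^sub>\<infinity>p. card {q. (p, q) \<in> E} = b)"

end

theory Submission
  imports Defs "HOL-Computational_Algebra.Fundamental_Theorem_Algebra"
begin

text \<open>The tangent lines at \<open>p \<in> C\<^sub>1\<close> and \<open>q \<in> C\<^sub>2\<close> lie in different planes, so a common point of them lies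
  on the line \<open>L\<close> in which the two planes meet. Write \<open>C\<^sub>i\<close> as \<open>h\<^sub>i = 0\<close>, \<open>B\<^sub>i x x = 0\<close> with a symmetric
  bilinear form \<open>B\<^sub>i\<close>. The tangent line at \<open>x\<close> is \<open>h\<^sub>i = 0\<close>, \<open>B\<^sub>i x y = 0\<close>
  (\<open>tangent_space_conic\<close>). If \<open>u, v\<close> is a basis of \<open>L\<close>, the two tangent lines therefore meet exactly
  when the linear forms \<open>B\<^sub>1 p\<close> and \<open>B\<^sub>2 q\<close> have a common zero in the span of \<open>u\<close> and \<open>v\<close>, that is,
  when the determinant
  \<open>B\<^sub>1 p u * B\<^sub>2 q v - B\<^sub>1 p v * B\<^sub>2 q u\<close> is zero (\<open>tangents_meet_iff\<close>). It is bilinear in \<open>p\<close> and \<open>q\<close>;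
  as the line parametrizes a conic by quadratic forms, it pulls back to a form of bidegree \<open>(2, 2)\<close>.

  Three points remain.

  The edge curve is the closure of the zero locus of the determinant with the pairs
  \<open>(p, p)\<close>, \<open>p \<in> C\<^sub>1 \<inter> C\<^sub>2\<close>, removed, and these pairs have to be recovered. No point of a plane curve is
  isolated: near \<open>(p, p)\<close> the equation is quadratic in the second parameter, and one of its
  roots tends to the given one, so \<open>(p, p)\<close> is a limit of points with \<open>p \<noteq> q\<close>
  (\<open>biform_vanishes_at_common_point\<close>, \<open>edge_curve_eq\<close>).

  The isomorphism with the projective line is arbitrary. Sending infinity and zero to two chosen
  points of the conic, it becomes an injective map of the affine line that is locally a
  quotient of polynomials; such a map is a polynomial of degree one. Hence every isomorphism is a
  standard quadratic parametrization in a suitable basis of the plane (\<open>isomorphism_veronese\<close>).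

  Finally, for general \<open>q\<close> there are exactly two points \<open>p\<close>. The pulled back form is
  \<open>a(x) * b'(y) - b(x) * a'(y)\<close> with binary quadratic forms such that \<open>a, b\<close> are linearly
  independent, and so are \<open>a', b'\<close>. For fixed \<open>y\<close> it is a member of the pencil of \<open>a\<close> and \<open>b\<close>, and
  the discriminant of a pencil of binary quadratics is not identically zero
  (\<open>pencil_discriminant\<close>, \<open>general_fibre_two_points\<close>).\<close>

section \<open>Forms and biforms\<close>

lemma finite_exponents: "finite (exponents d :: ('n::finite \<Rightarrow> nat) set)"
proof (rule finite_subset)
  show "exponents d \<subseteq> PiE (UNIV :: 'n set) (\<lambda>_. {..d})"
    by (auto simp: exponents_def intro: member_le_sum)
qed (simp add: finite_PiE)

lemma form_monomial:
  assumes "m \<in> exponents d"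
  shows "form d (monomial m)"
proof -
  have "(\<Sum>n\<in>exponents d. (if n = m then 1 else 0) * monomial n v) = monomial m v" for v
    using assms by (simp add: if_distrib[where f = "\<lambda>x. x * _"] sum.delta finite_exponents cong: if_cong)
  then show ?thesis unfolding form_def by metis
qed

lemma form_zero: "form d (\<lambda>_. 0)"
  unfolding form_def by (rule exI[of _ "\<lambda>_. 0"]) simp

lemma form_add:
  assumes "form d F" "form d G"
  shows "form d (\<lambda>v. F v + G v)"
proof -
  from assms obtain c c' where F: "F = (\<lambda>v. \<Sum>m\<in>exponents d. c m * monomial m v)"
    and G: "G = (\<lambda>v. \<Sum>m\<in>exponents d. c' m * monomial m v)"
    unfolding form_def by blast
  show ?thesis unfolding form_def F G
    by (rule exI[of _ "\<lambda>m. c m + c' m"]) (simp add: sum.distrib distrib_right)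
qed

lemma form_cmult:
  assumes "form d F"
  shows "form d (\<lambda>v. k * F v)"
proof -
  from assms obtain c where F: "F = (\<lambda>v. \<Sum>m\<in>exponents d. c m * monomial m v)"
    unfolding form_def by blast
  show ?thesis unfolding form_def F
    by (rule exI[of _ "\<lambda>m. k * c m"]) (simp add: sum_distrib_left mult.assoc)
qed

lemma form_sum: "(\<And>a. a \<in> S \<Longrightarrow> form d (F a)) \<Longrightarrow> form d (\<lambda>v. \<Sum>a\<in>S. F a v)"
  by (induction S rule: infinite_finite_induct) (auto intro: form_zero form_add)

lemma monomial_add: "monomial (\<lambda>i. m i + n i) v = monomial m v * monomial n v"
  by (simp add: monomial_def power_add prod.distrib)

lemma form_mult:
  assumes "form d F" "form e G"
  shows "form (d + e) (\<lambda>v. F v * G v)"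
proof -
  from assms obtain c c' where F: "F = (\<lambda>v. \<Sum>m\<in>exponents d. c m * monomial m v)"
    and G: "G = (\<lambda>v. \<Sum>n\<in>exponents e. c' n * monomial n v)"
    unfolding form_def by blast
  have "form (d + e) (\<lambda>v. \<Sum>m\<in>exponents d. \<Sum>n\<in>exponents e.
          (c m * c' n) * monomial (\<lambda>i. m i + n i) v)"
    by (intro form_sum form_cmult form_monomial) (auto simp: exponents_def sum.distrib)
  then show ?thesis
    unfolding F G sum_product by (simp add: monomial_add mult_ac)
qed

lemma form_const: "form 0 (\<lambda>_. k)"
proof -
  have "form 0 (monomial (\<lambda>_. 0) :: complex ^ 'n \<Rightarrow> complex)"
    by (rule form_monomial) (simp add: exponents_def)
  from form_cmult[OF this, of k] show ?thesis by (simp add: monomial_def)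
qed

lemma form_component: "form 1 (\<lambda>v. v $ i)"
proof -
  have "form 1 (monomial (\<lambda>j. if j = i then 1 else 0))"
    by (rule form_monomial) (simp add: exponents_def)
  then show ?thesis
    by (simp add: monomial_def[abs_def] if_distrib[where f = "\<lambda>k. _ ^ k"] cong: if_cong)
qed

lemma form_power: "form d F \<Longrightarrow> form (d * k) (\<lambda>v. F v ^ k)"
proof (induction k)
  case (Suc k)
  then show ?case using form_mult[of d F "d * k" "\<lambda>v. F v ^ k"] by simp
qed (simp add: form_const)

lemma form_prod:
  "finite S \<Longrightarrow> (\<And>i. i \<in> S \<Longrightarrow> form (e i) (F i)) \<Longrightarrow> form (\<Sum>i\<in>S. e i) (\<lambda>v. \<Prod>i\<in>S. F i v)"
  by (induction S rule: finite_induct) (auto intro: form_const form_mult)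

lemma form_compose:
  assumes F: "form d F" and G: "\<And>i. form e (\<lambda>v. G v $ i)"
  shows "form (d * e) (\<lambda>v. F (G v))"
proof -
  from F obtain c where F: "F = (\<lambda>v. \<Sum>m\<in>exponents d. c m * monomial m v)"
    unfolding form_def by blast
  have "form (d * e) (\<lambda>v. monomial m (G v))" if "m \<in> exponents d" for m
  proof -
    have "form (\<Sum>i\<in>UNIV. e * m i) (\<lambda>v. \<Prod>i\<in>UNIV. (G v $ i) ^ m i)"
      by (intro form_prod form_power G) simp
    with that show ?thesis
      by (simp add: monomial_def exponents_def sum_distrib_left[symmetric] mult.commute)
  qed
  then show ?thesis
    unfolding F by (intro form_sum form_cmult)
qed

lemma monomial_scale: "m \<in> exponents d \<Longrightarrow> monomial m (k *s v) = k ^ d * monomial m v"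
  by (simp add: monomial_def exponents_def power_mult_distrib prod.distrib power_sum[symmetric])

lemma form_scale:
  assumes "form d F"
  shows "F (k *s v) = k ^ d * F v"
proof -
  from assms obtain c where F: "F = (\<lambda>v. \<Sum>m\<in>exponents d. c m * monomial m v)"
    unfolding form_def by blast
  show ?thesis unfolding F sum_distrib_left
    by (intro sum.cong refl) (simp add: monomial_scale mult_ac)
qed

lemma biform_scale:
  assumes "biform d e F"
  shows "F (k *s v) (l *s w) = k ^ d * l ^ e * F v w"
proof -
  from assms obtain c where F: "F = (\<lambda>v w. \<Sum>m\<in>exponents d. \<Sum>n\<in>exponents e.
      c m n * monomial m v * monomial n w)"
    unfolding biform_def by blast
  show ?thesis unfolding F sum_distrib_left
    by (intro sum.cong refl) (simp add: monomial_scale mult_ac)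
qed

lemma biform_mult:
  assumes "form d F" "form e G"
  shows "biform d e (\<lambda>v w. F v * G w)"
proof -
  from assms obtain c c' where F: "F = (\<lambda>v. \<Sum>m\<in>exponents d. c m * monomial m v)"
    and G: "G = (\<lambda>v. \<Sum>n\<in>exponents e. c' n * monomial n v)"
    unfolding form_def by blast
  show ?thesis unfolding biform_def
    by (rule exI[of _ "\<lambda>m n. c m * c' n"]) (simp add: F G sum_product fun_eq_iff mult_ac)
qed

lemma biform_diff:
  assumes "biform d e F" "biform d e G"
  shows "biform d e (\<lambda>v w. F v w - G v w)"
proof -
  from assms obtain c c' where F: "F = (\<lambda>v w. \<Sum>m\<in>exponents d. \<Sum>n\<in>exponents e.
      c m n * monomial m v * monomial n w)"
    and G: "G = (\<lambda>v w. \<Sum>m\<in>exponents d. \<Sum>n\<in>exponents e.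
      c' m n * monomial m v * monomial n w)"
    unfolding biform_def by blast
  show ?thesis unfolding biform_def F G
    by (rule exI[of _ "\<lambda>m n. c m n - c' m n"]) (simp add: sum_subtractf left_diff_distrib)
qed

lemma biform_tendsto:
  assumes "biform d e G"
    and "\<And>i. ((\<lambda>x. v x $ i) \<longlongrightarrow> v0 $ i) A" "\<And>i. ((\<lambda>x. w x $ i) \<longlongrightarrow> w0 $ i) A"
  shows "((\<lambda>x. G (v x) (w x)) \<longlongrightarrow> G v0 w0) A"
proof -
  from assms(1) obtain c where G: "G = (\<lambda>v w. \<Sum>m\<in>exponents d. \<Sum>n\<in>exponents e.
      c m n * monomial m v * monomial n w)"
    unfolding biform_def by blast
  show ?thesis unfolding G monomial_def by (intro tendsto_intros assms(2,3))
qed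

text \<open>Splitting off one coordinate from each monomial. Applied once or twice, this turns forms of
  degree one and two into linear forms and symmetric bilinear forms.\<close>

lemma form_Suc_decompose:
  assumes "form (Suc d) F"
  shows "\<exists>G. (\<forall>i. form d (G i)) \<and> (\<forall>v. F v = (\<Sum>i\<in>UNIV. v $ i * G i v))"
proof -
  from assms obtain c where F: "F = (\<lambda>v. \<Sum>m\<in>exponents (Suc d). c m * monomial m v)"
    unfolding form_def by blast
  have "\<exists>i. m i > 0" if "m \<in> exponents (Suc d)" for m :: "'a \<Rightarrow> nat"
  proof (rule ccontr)
    assume "\<not> (\<exists>i. m i > 0)"
    then show False using that by (simp add: exponents_def)
  qed
  then obtain pos where pos: "m (pos m) > 0" if "m \<in> exponents (Suc d)" for m :: "'a \<Rightarrow> nat"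
    by metis
  \<comment> \<open>Lowering by one the exponent of a coordinate that occurs in \<open>m\<close>.\<close>
  define low where "low m = m(pos m := m (pos m) - 1)" for m :: "'a \<Rightarrow> nat"
  have m_eq: "m = (\<lambda>i. (if i = pos m then 1 else 0) + low m i)" if "m \<in> exponents (Suc d)" for m
    using pos[OF that] by (auto simp: low_def)
  have low: "low m \<in> exponents d" if "m \<in> exponents (Suc d)" for m
  proof -
    have "(\<Sum>i\<in>UNIV. m i) = (\<Sum>i\<in>UNIV. (if i = pos m then 1 else 0) + low m i)"
      by (rule arg_cong[where f = "\<lambda>m. sum m UNIV", OF m_eq[OF that]])
    then show ?thesis using that by (simp add: exponents_def sum.distrib)
  qed
  have mono: "monomial m v = v $ pos m * monomial (low m) v" if "m \<in> exponents (Suc d)" for m v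
  proof -
    have "monomial m v = monomial (\<lambda>i. if i = pos m then 1 else 0) v * monomial (low m) v"
      by (subst m_eq[OF that]) (rule monomial_add)
    then show ?thesis
      by (simp add: monomial_def if_distrib[where f = "\<lambda>k. _ ^ k"] cong: if_cong)
  qed
  define G where "G i v = (\<Sum>m\<in>exponents (Suc d).
      (if pos m = i then c m else 0) * monomial (low m) v)" for i v
  have "form d (G i)" for i
    unfolding G_def by (intro form_sum form_cmult form_monomial low)
  moreover have "F v = (\<Sum>i\<in>UNIV. v $ i * G i v)" for v
  proof -
    have "(\<Sum>i\<in>UNIV. v $ i * G i v)
        = (\<Sum>m\<in>exponents (Suc d). \<Sum>i\<in>UNIV. v $ i * ((if pos m = i then c m else 0) * monomial (low m) v))"
      unfolding G_def sum_distrib_left by (rule sum.swap)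
    also have "\<dots> = (\<Sum>m\<in>exponents (Suc d). c m * monomial m v)"
    proof (rule sum.cong[OF refl])
      fix m :: "'a \<Rightarrow> nat" assume m: "m \<in> exponents (Suc d)"
      have "(\<Sum>i\<in>UNIV. v $ i * ((if pos m = i then c m else 0) * monomial (low m) v))
          = (\<Sum>i\<in>UNIV. if pos m = i then v $ i * (c m * monomial (low m) v) else 0)"
        by (intro sum.cong) auto
      then show "(\<Sum>i\<in>UNIV. v $ i * ((if pos m = i then c m else 0) * monomial (low m) v))
          = c m * monomial m v"
        by (simp add: mono[OF m])
    qed
    finally show ?thesis by (simp add: F)
  qed
  ultimately show ?thesis by blast
qed

lemma form_0_constant: "form 0 F \<Longrightarrow> \<exists>k. F = (\<lambda>_. k)"
proof -
  have "exponents 0 = {\<lambda>_::'a. 0}" by (auto simp: exponents_def)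
  then show "form 0 F \<Longrightarrow> \<exists>k. F = (\<lambda>_. k)" unfolding form_def monomial_def by auto
qed

lemma form_1_coefficients:
  assumes "form 1 F"
  obtains c where "\<And>v. F v = (\<Sum>i\<in>UNIV. c i * v $ i)"
proof -
  obtain G where G: "\<forall>i. form 0 (G i)" "\<forall>v. F v = (\<Sum>i\<in>UNIV. v $ i * G i v)"
    using form_Suc_decompose[of 0 F] assms by auto
  have "\<forall>i. \<exists>k. G i = (\<lambda>_. k)" using G(1) form_0_constant by blast
  then obtain c where "\<forall>i. G i = (\<lambda>_. c i)" by metis
  with G(2) show thesis by (intro that[of c]) (simp add: mult.commute)
qed

lemma form_1_linear:
  assumes "form 1 F"
  shows "F (x + y) = F x + F y" "F (k *s x) = k * F x" "F (x - y) = F x - F y" "F 0 = 0"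
proof -
  obtain c where "\<And>v. F v = (\<Sum>i\<in>UNIV. c i * v $ i)" using form_1_coefficients[OF assms] by blast
  then show "F (x + y) = F x + F y" "F (k *s x) = k * F x" "F (x - y) = F x - F y" "F 0 = 0"
    by (simp_all add: distrib_left right_diff_distrib sum.distrib sum_subtractf sum_distrib_left
        mult.left_commute[of k])
qed

lemma form_2_polarization:
  assumes "form 2 Q"
  obtains B where "\<And>x. Q x = B x x" "\<And>x y. B x y = B y x" "\<And>x. form 1 (B x)"
proof -
  obtain G where G: "\<forall>i. form 1 (G i)" "\<forall>v. Q v = (\<Sum>i\<in>UNIV. v $ i * G i v)"
    using form_Suc_decompose[of 1 Q] assms unfolding Suc_1 by blast
  define B where "B x y = (\<Sum>i\<in>UNIV. (1 / 2) * (x $ i * G i y + G i x * y $ i))" for x y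
  have "Q x = B x x" for x by (simp add: B_def G(2) mult.commute)
  moreover have "B x y = B y x" for x y by (simp add: B_def algebra_simps)
  moreover have "form 1 (B x)" for x
    unfolding B_def by (intro form_sum form_cmult form_add G(1)[rule_format] form_component)
  ultimately show thesis by (rule that)
qed

text \<open>By the chain rule, the derivative of a form along a curve depends only on the point and the
  tangent vector of the curve. Differentials, defined along straight lines, can therefore be computed
  along a curve on which the form is known to vanish.\<close>

lemma form_along_curve:
  fixes F :: "complex ^ 'n \<Rightarrow> complex"
  assumes "form d F"
  obtains D where "\<And>\<gamma>. (\<And>i. ((\<lambda>t. \<gamma> t $ i) has_field_derivative w $ i) (at 0)) \<Longrightarrow> \<gamma> 0 = p
     \<Longrightarrow> ((\<lambda>t. F (\<gamma> t)) has_field_derivative D) (at 0)"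
proof -
  from assms obtain c where F: "F = (\<lambda>v. \<Sum>m\<in>exponents d. c m * monomial m v)"
    unfolding form_def by blast
  define D where "D = (\<Sum>m\<in>exponents d. c m * (\<Sum>i\<in>UNIV.
     (of_nat (m i) * (w $ i * p $ i ^ (m i - Suc 0))) * (\<Prod>j\<in>UNIV - {i}. p $ j ^ m j)))"
  show thesis
  proof (rule that[of D])
    fix \<gamma> :: "complex \<Rightarrow> complex ^ 'n"
    assume \<gamma>: "\<And>i. ((\<lambda>t. \<gamma> t $ i) has_field_derivative w $ i) (at 0)" and [simp]: "\<gamma> 0 = p"
    have *: "((\<lambda>t. \<gamma> t $ i ^ k) has_field_derivative of_nat k * (w $ i * p $ i ^ (k - Suc 0))) (at 0)"
      for i k using DERIV_power[OF \<gamma>, of i k] by simp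
    have "((\<lambda>t. monomial m (\<gamma> t)) has_field_derivative (\<Sum>i\<in>UNIV.
     (of_nat (m i) * (w $ i * p $ i ^ (m i - Suc 0))) * (\<Prod>j\<in>UNIV - {i}. p $ j ^ m j))) (at 0)" for m
      unfolding monomial_def
      using has_field_derivative_prod[of UNIV "\<lambda>i t. \<gamma> t $ i ^ m i", OF *] by simp
    then show "((\<lambda>t. F (\<gamma> t)) has_field_derivative D) (at 0)"
      unfolding F D_def by (intro DERIV_sum DERIV_cmult)
  qed
qed

lemma form_dehomogenize:
  fixes F :: "complex ^ 2 \<Rightarrow> complex"
  assumes "form d F"
  obtains p where "\<And>z. F (vector [z, 1]) = poly p z"
proof -
  from assms obtain c where F: "F = (\<lambda>v. \<Sum>m\<in>exponents d. c m * monomial m v)"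
    unfolding form_def by blast
  show thesis
    by (rule that[of "\<Sum>m\<in>exponents d. Polynomial.monom (c m) (m 1)"])
       (simp add: F monomial_def poly_sum poly_monom UNIV_2)
qed

section \<open>Homogeneous coordinates\<close>

lemma rep_proj_nonzero: "rep_proj p \<noteq> 0"
  using Quotient_rep_reflp[OF Quotient_proj, of p] by (simp add: proj_rel_def)

lemma abs_rep_proj [simp]: "abs_proj (rep_proj p) = p"
  by (rule Quotient_abs_rep[OF Quotient_proj])

lemma rep_abs_proj:
  assumes "v \<noteq> 0"
  shows "\<exists>c. c \<noteq> 0 \<and> rep_proj (abs_proj v) = c *s v"
proof -
  have "proj_rel v v" using assms by (auto simp: proj_rel_def intro: exI[of _ 1])
  then have "proj_rel (rep_proj (abs_proj v)) v"
    by (rule Quotient_rep_abs[OF Quotient_proj])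
  then have "proj_rel v (rep_proj (abs_proj v))"
    by (rule part_equivp_symp[OF part_equivp_proj_rel])
  then show ?thesis by (auto simp: proj_rel_def)
qed

lemma abs_proj_scale: "v \<noteq> 0 \<Longrightarrow> c \<noteq> 0 \<Longrightarrow> abs_proj (c *s v) = abs_proj v"
  by (rule sym, rule Quotient_rel_abs[OF Quotient_proj]) (auto simp: proj_rel_def)

lemma abs_proj_eqD:
  assumes "abs_proj v = abs_proj w" "v \<noteq> 0" "w \<noteq> 0"
  shows "\<exists>c. c \<noteq> 0 \<and> w = c *s v"
proof -
  obtain a where a: "a \<noteq> 0" "rep_proj (abs_proj v) = a *s v"
    using rep_abs_proj[OF assms(2)] by blast
  obtain b where b: "b \<noteq> 0" "rep_proj (abs_proj w) = b *s w"
    using rep_abs_proj[OF assms(3)] by blast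
  have "b *s w = a *s v" using a b assms(1) by simp
  then have "w = (a / b) *s v"
    using b(1) by (simp add: vec_eq_iff field_simps)
  with a(1) b(1) show ?thesis by (intro exI[of _ "a / b"]) simp
qed

lemma zero_at_abs_proj:
  assumes "form d F" "v \<noteq> 0"
  shows "zero_at F (abs_proj v) \<longleftrightarrow> F v = 0"
proof -
  obtain a where "a \<noteq> 0" "rep_proj (abs_proj v) = a *s v"
    using rep_abs_proj[OF assms(2)] by blast
  then show ?thesis by (simp add: zero_at_def form_scale[OF assms(1)])
qed

lemma bizeros_abs_proj:
  assumes "biform d e F" "v \<noteq> 0" "w \<noteq> 0"
  shows "(abs_proj v, abs_proj w) \<in> bizeros F \<longleftrightarrow> F v w = 0"
proof -
  obtain a where a: "a \<noteq> 0" "rep_proj (abs_proj v) = a *s v"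
    using rep_abs_proj[OF assms(2)] by blast
  obtain b where b: "b \<noteq> 0" "rep_proj (abs_proj w) = b *s w"
    using rep_abs_proj[OF assms(3)] by blast
  from a b show ?thesis by (simp add: bizeros_def biform_scale[OF assms(1)])
qed

lemma distinct_points_independent:
  assumes "p \<noteq> q" and 0: "\<alpha> *s rep_proj p + \<gamma> *s rep_proj q = 0"
  shows "\<alpha> = 0 \<and> \<gamma> = 0"
proof (rule ccontr)
  assume ne: "\<not> (\<alpha> = 0 \<and> \<gamma> = 0)"
  have eq: "\<gamma> *s rep_proj q = (- \<alpha>) *s rep_proj p"
    using 0 by (simp add: add_eq_0_iff)
  have "\<gamma> \<noteq> 0" "\<alpha> \<noteq> 0"
    using ne eq rep_proj_nonzero[of p] rep_proj_nonzero[of q] by (auto simp: vec_eq_iff)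
  then have "abs_proj (\<gamma> *s rep_proj q) = q" "abs_proj ((- \<alpha>) *s rep_proj p) = p"
    by (simp_all only: abs_proj_scale rep_proj_nonzero abs_rep_proj neg_equal_0_iff_equal not_False_eq_True)
  with eq assms(1) show False by metis
qed

section \<open>Linear algebra in four-space\<close>

text \<open>The \<open>4 \<times> 4\<close> matrix with the three forms as rows and a row of zeros is singular.\<close>

lemma three_linear_forms_common_zero:
  fixes f g h :: "complex ^ 4 \<Rightarrow> complex"
  assumes "form 1 f" "form 1 g" "form 1 h"
  shows "\<exists>x. x \<noteq> 0 \<and> f x = 0 \<and> g x = 0 \<and> h x = 0"
proof -
  obtain a where a: "\<And>x. f x = (\<Sum>i\<in>UNIV. a i * x $ i)" using form_1_coefficients[OF assms(1)] by blast
  obtain b where b: "\<And>x. g x = (\<Sum>i\<in>UNIV. b i * x $ i)" using form_1_coefficients[OF assms(2)] by blast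
  obtain c where c: "\<And>x. h x = (\<Sum>i\<in>UNIV. c i * x $ i)" using form_1_coefficients[OF assms(3)] by blast
  define A :: "complex ^ 4 ^ 4" where
    "A = (\<chi> i j. if i = 1 then a j else if i = 2 then b j else if i = 3 then c j else 0)"
  have "row 4 A = 0" by (simp add: row_def A_def vec_eq_iff)
  then have "\<not> invertible A" by (simp add: invertible_det_nz det_zero_row)
  then obtain x where x: "x \<noteq> 0" "A *v x = 0"
    unfolding invertible_left_inverse matrix_left_invertible_ker by blast
  have "(A *v x) $ 1 = f x" "(A *v x) $ 2 = g x" "(A *v x) $ 3 = h x"
    by (simp_all add: matrix_vector_mult_def A_def a b c)
  with x show ?thesis by auto
qed

lemma four_independent_vectors_span:
  fixes a b c d x :: "complex ^ 4"
  assumes "\<And>\<alpha> \<beta> \<gamma> \<delta>. \<alpha> *s a + \<beta> *s b + \<gamma> *s c + \<delta> *s d = 0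
     \<Longrightarrow> \<alpha> = 0 \<and> \<beta> = 0 \<and> \<gamma> = 0 \<and> \<delta> = 0"
  shows "\<exists>\<alpha> \<beta> \<gamma> \<delta>. x = \<alpha> *s a + \<beta> *s b + \<gamma> *s c + \<delta> *s d"
proof -
  define A :: "complex ^ 4 ^ 4" where
    "A = (\<chi> i j. if j = 1 then a $ i else if j = 2 then b $ i else if j = 3 then c $ i else d $ i)"
  have mult: "A *v y = y $ 1 *s a + y $ 2 *s b + y $ 3 *s c + y $ 4 *s d" for y
    by (simp add: vec_eq_iff matrix_vector_mult_def A_def sum_4 mult.commute)
  have "y = 0" if "A *v y = 0" for y
    using assms[of "y $ 1" "y $ 2" "y $ 3" "y $ 4"] that
    unfolding mult vec_eq_iff[of y 0] forall_4 by simp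
  then have "\<exists>B. B ** A = mat 1" by (simp add: matrix_left_invertible_ker)
  then obtain B where "A ** B = mat 1" by (auto simp: matrix_left_right_inverse)
  then have "A *v (B *v x) = x" by (simp add: matrix_vector_mul_assoc)
  then show ?thesis unfolding mult by metis
qed

text \<open>Two vectors \<open>u, v\<close> of the plane that are orthogonal with respect to \<open>B\<close> exist by a count of linear
  conditions; unless \<open>u\<close> is isotropic itself, some \<open>v + r u\<close> is, since the complex
  numbers contain square roots. The case \<open>h = 0\<close> is included in order to rule it out: it gives
  every smooth conic a point at which the Jacobian criterion can be applied.\<close>

lemma isotropic_vector_exists:
  fixes h :: "complex ^ 4 \<Rightarrow> complex" and B :: "complex ^ 4 \<Rightarrow> complex ^ 4 \<Rightarrow> complex"
  assumes h: "form 1 h" and B: "\<And>x. form 1 (B x)" and sym: "\<And>x y. B x y = B y x"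
  shows "\<exists>x. x \<noteq> 0 \<and> h x = 0 \<and> B x x = 0"
proof -
  have left: "B (x + y) z = B x z + B y z" "B (c *s x) z = c * B x z" for x y z c
    using form_1_linear[OF B] by (simp_all add: sym[of _ z])
  obtain u where u: "u \<noteq> 0" "h u = 0"
    using three_linear_forms_common_zero[OF h h h] by blast
  show ?thesis
  proof (cases "B u u = 0")
    case True
    with u show ?thesis by blast
  next
    case False
    obtain v where v: "v \<noteq> 0" "h v = 0" "B u v = 0"
      using three_linear_forms_common_zero[OF h B B] by blast
    define r where "r = csqrt (- B v v / B u u)"
    have r: "r * (r * B u u) = - B v v"
      using False power2_csqrt[of "- B v v / B u u"]
      by (simp add: r_def power2_eq_square mult.assoc[symmetric])
    have "v + r *s u \<noteq> 0"
    proof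
      assume 0: "v + r *s u = 0"
      then have "B u (v + r *s u) = 0" by (simp add: form_1_linear[OF B])
      with v False have "r = 0" by (simp add: form_1_linear[OF B])
      with 0 v show False by simp
    qed
    moreover have "h (v + r *s u) = 0" "B (v + r *s u) (v + r *s u) = 0"
      using u v r by (simp_all add: form_1_linear[OF h] form_1_linear[OF B] left sym[of v u])
    ultimately show ?thesis by blast
  qed
qed

section \<open>Smooth conics and their quadratic parametrizations\<close>

text \<open>The parametrization of a conic that is the image of \<open>x z = y\<^sup>2\<close> under a choice of a basis of its plane.\<close>

definition veronese ::
  "complex ^ 4 \<Rightarrow> complex ^ 4 \<Rightarrow> complex ^ 4 \<Rightarrow> complex ^ 2 \<Rightarrow> complex ^ 4" where
  "veronese a\<^sub>0 a\<^sub>1 a\<^sub>2 v = (v $ 1)\<^sup>2 *s a\<^sub>0 + (v $ 1 * v $ 2) *s a\<^sub>1 + (v $ 2)\<^sup>2 *s a\<^sub>2"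

lemma veronese_scale: "veronese a b c (l *s v) = l\<^sup>2 *s veronese a b c v"
  by (simp add: veronese_def vec_eq_iff power2_eq_square algebra_simps)

lemma form_linear_veronese:
  assumes "form 1 f"
  shows "form 2 (\<lambda>v. f (veronese a\<^sub>0 a\<^sub>1 a\<^sub>2 v))"
proof -
  have "form 2 (\<lambda>v :: complex ^ 2. f a\<^sub>0 * (v $ 1)\<^sup>2 + f a\<^sub>1 * (v $ 1 * v $ 2) + f a\<^sub>2 * (v $ 2)\<^sup>2)"
    using form_mult[OF form_component form_component, of 1 2]
      form_power[OF form_component, where k = 2, of 1] form_power[OF form_component, where k = 2, of 2]
    by (intro form_add form_cmult) (simp_all add: numeral_2_eq_2)
  then show ?thesis
    by (simp add: veronese_def form_1_linear[OF assms] mult.commute)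
qed

locale plane_conic =
  fixes C :: "4 proj set" and h :: "complex ^ 4 \<Rightarrow> complex"
    and B :: "complex ^ 4 \<Rightarrow> complex ^ 4 \<Rightarrow> complex"
  assumes conic_eq: "C = {p. h (rep_proj p) = 0 \<and> B (rep_proj p) (rep_proj p) = 0}"
    and form_h: "form 1 h" and h_nonzero: "\<exists>e. h e \<noteq> 0"
    and form_Q: "form 2 (\<lambda>x. B x x)" and form_B: "form 1 (B x)" and B_sym: "B x y = B y x"
    and nondegenerate: "h x = 0 \<Longrightarrow> x \<noteq> 0 \<Longrightarrow> \<exists>y. h y = 0 \<and> B x y \<noteq> 0"
begin

lemmas h_linear = form_1_linear[OF form_h]

lemma B_linear:
  "B x (y + z) = B x y + B x z" "B x (c *s y) = c * B x y" "B x (y - z) = B x y - B x z" "B x 0 = 0"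
  "B (y + z) x = B y x + B z x" "B (c *s y) x = c * B y x" "B (y - z) x = B y x - B z x" "B 0 x = 0"
  using form_1_linear[OF form_B] by (simp_all add: B_sym[of _ x])

text \<open>A basis of the plane in which the conic is \<open>x z = y\<^sup>2\<close>, up to the scalar \<open>k\<close>. Geometrically, \<open>a\<^sub>0\<close> and
  \<open>a\<^sub>2\<close> are points of the conic and \<open>a\<^sub>1\<close> is the intersection of their tangents. The
  scalar is kept, as it allows \<open>a\<^sub>0\<close> and \<open>a\<^sub>2\<close> to be prescribed vectors.\<close>

definition frame :: "complex \<Rightarrow> complex ^ 4 \<Rightarrow> complex ^ 4 \<Rightarrow> complex ^ 4 \<Rightarrow> bool" where
  "frame k a\<^sub>0 a\<^sub>1 a\<^sub>2 \<longleftrightarrow> k \<noteq> 0 \<and> h a\<^sub>0 = 0 \<and> h a\<^sub>1 = 0 \<and> h a\<^sub>2 = 0 \<and>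
     B a\<^sub>0 a\<^sub>0 = 0 \<and> B a\<^sub>0 a\<^sub>1 = 0 \<and> B a\<^sub>1 a\<^sub>2 = 0 \<and> B a\<^sub>2 a\<^sub>2 = 0 \<and> B a\<^sub>0 a\<^sub>2 = k \<and> B a\<^sub>1 a\<^sub>1 = - 2 * k"

lemma plane_spanned:
  assumes "h a = 0" "h b = 0" "h c = 0"
    and "\<And>\<alpha> \<beta> \<gamma>. \<alpha> *s a + \<beta> *s b + \<gamma> *s c = 0 \<Longrightarrow> \<alpha> = 0 \<and> \<beta> = 0 \<and> \<gamma> = 0"
    and "h x = 0"
  shows "\<exists>\<alpha> \<beta> \<gamma>. x = \<alpha> *s a + \<beta> *s b + \<gamma> *s c"
proof -
  obtain e where e: "h e \<noteq> 0" using h_nonzero by blast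
  have "\<exists>\<alpha> \<beta> \<gamma> \<delta>. x = \<alpha> *s a + \<beta> *s b + \<gamma> *s c + \<delta> *s e"
  proof (rule four_independent_vectors_span)
    fix \<alpha> \<beta> \<gamma> \<delta> assume 0: "\<alpha> *s a + \<beta> *s b + \<gamma> *s c + \<delta> *s e = 0"
    then have "h (\<alpha> *s a + \<beta> *s b + \<gamma> *s c + \<delta> *s e) = 0" by (simp add: h_linear)
    then have "\<delta> = 0" using e assms(1-3) by (simp add: h_linear)
    with 0 assms(4)[of \<alpha> \<beta> \<gamma>] show "\<alpha> = 0 \<and> \<beta> = 0 \<and> \<gamma> = 0 \<and> \<delta> = 0" by simp
  qed
  then obtain \<alpha> \<beta> \<gamma> \<delta> where x: "x = \<alpha> *s a + \<beta> *s b + \<gamma> *s c + \<delta> *s e" by blast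
  have "h x = \<delta> * h e" unfolding x using assms(1-3) by (simp add: h_linear)
  then have "\<delta> = 0" using e assms(5) by simp
  with x show ?thesis by auto
qed

lemma frame_expansion:
  assumes F: "frame k a\<^sub>0 a\<^sub>1 a\<^sub>2" and "h x = 0"
  shows "x = (B a\<^sub>2 x / k) *s a\<^sub>0 + (- B a\<^sub>1 x / (2 * k)) *s a\<^sub>1 + (B a\<^sub>0 x / k) *s a\<^sub>2"
proof -
  note F' = F[unfolded frame_def]
  have "\<exists>\<alpha> \<beta> \<gamma>. x = \<alpha> *s a\<^sub>0 + \<beta> *s a\<^sub>1 + \<gamma> *s a\<^sub>2"
  proof (rule plane_spanned)
    fix \<alpha> \<beta> \<gamma> assume 0: "\<alpha> *s a\<^sub>0 + \<beta> *s a\<^sub>1 + \<gamma> *s a\<^sub>2 = 0"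
    have "B y (\<alpha> *s a\<^sub>0 + \<beta> *s a\<^sub>1 + \<gamma> *s a\<^sub>2) = 0" for y unfolding 0 by (simp add: B_linear)
    from this[of a\<^sub>0] this[of a\<^sub>1] this[of a\<^sub>2] show "\<alpha> = 0 \<and> \<beta> = 0 \<and> \<gamma> = 0"
      using F' by (simp add: B_linear B_sym[of a\<^sub>1 a\<^sub>0] B_sym[of a\<^sub>2 a\<^sub>0] B_sym[of a\<^sub>2 a\<^sub>1])
  qed (use F' assms(2) in auto)
  then obtain \<alpha> \<beta> \<gamma> where x: "x = \<alpha> *s a\<^sub>0 + \<beta> *s a\<^sub>1 + \<gamma> *s a\<^sub>2" by blast
  have "B a\<^sub>0 x = k * \<gamma>" "B a\<^sub>1 x = - 2 * k * \<beta>" "B a\<^sub>2 x = k * \<alpha>"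
    unfolding x using F' by (simp_all add: B_linear B_sym[of a\<^sub>1 a\<^sub>0] B_sym[of a\<^sub>2 a\<^sub>0] B_sym[of a\<^sub>2 a\<^sub>1])
  with F' x show ?thesis by simp
qed

lemma frame_veronese:
  assumes F: "frame k a\<^sub>0 a\<^sub>1 a\<^sub>2"
  shows "h (veronese a\<^sub>0 a\<^sub>1 a\<^sub>2 v) = 0"
    and "B (veronese a\<^sub>0 a\<^sub>1 a\<^sub>2 v) (veronese a\<^sub>0 a\<^sub>1 a\<^sub>2 v) = 0"
    and "B a\<^sub>0 (veronese a\<^sub>0 a\<^sub>1 a\<^sub>2 v) = k * (v $ 2)\<^sup>2"
    and "B a\<^sub>1 (veronese a\<^sub>0 a\<^sub>1 a\<^sub>2 v) = - 2 * k * (v $ 1 * v $ 2)"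
    and "B a\<^sub>2 (veronese a\<^sub>0 a\<^sub>1 a\<^sub>2 v) = k * (v $ 1)\<^sup>2"
  using F[unfolded frame_def]
  by (simp_all add: veronese_def h_linear B_linear B_sym[of a\<^sub>1 a\<^sub>0] B_sym[of a\<^sub>2 a\<^sub>0] B_sym[of a\<^sub>2 a\<^sub>1] power2_eq_square)

lemma frame_veronese_nonzero:
  assumes F: "frame k a\<^sub>0 a\<^sub>1 a\<^sub>2" and "v \<noteq> 0"
  shows "veronese a\<^sub>0 a\<^sub>1 a\<^sub>2 v \<noteq> 0"
proof
  assume "veronese a\<^sub>0 a\<^sub>1 a\<^sub>2 v = 0"
  with frame_veronese[OF F, of v] F have "v $ 1 = 0" "v $ 2 = 0"
    by (simp_all add: B_linear frame_def)
  with assms(2) show False by (simp add: vec_eq_iff forall_2)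
qed

lemma abs_proj_in_conic: "x \<noteq> 0 \<Longrightarrow> abs_proj x \<in> C \<longleftrightarrow> h x = 0 \<and> B x x = 0"
  using rep_abs_proj[of x] by (auto simp: conic_eq h_linear B_linear)

text \<open>On the conic the coordinates satisfy \<open>\<beta>\<^sup>2 = \<alpha> \<gamma>\<close>, so \<open>(\<alpha>, \<beta>)\<close> or, if \<open>\<alpha> = 0\<close>, \<open>(0, \<gamma>)\<close> is a parameter.\<close>

lemma frame_veronese_surj:
  assumes F: "frame k a\<^sub>0 a\<^sub>1 a\<^sub>2" and "h x = 0" "B x x = 0" "x \<noteq> 0"
  shows "\<exists>v c. v \<noteq> 0 \<and> c \<noteq> 0 \<and> veronese a\<^sub>0 a\<^sub>1 a\<^sub>2 v = c *s x"
proof -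
  note F' = F[unfolded frame_def]
  obtain \<alpha> \<beta> \<gamma> where x: "x = \<alpha> *s a\<^sub>0 + \<beta> *s a\<^sub>1 + \<gamma> *s a\<^sub>2"
    using frame_expansion[OF F assms(2)] by blast
  have "B x x = 2 * k * (\<alpha> * \<gamma> - \<beta>\<^sup>2)"
    unfolding x using F'
    by (simp add: B_linear B_sym[of a\<^sub>1 a\<^sub>0] B_sym[of a\<^sub>2 a\<^sub>0] B_sym[of a\<^sub>2 a\<^sub>1] power2_eq_square algebra_simps)
  then have \<beta>: "\<beta> * \<beta> = \<alpha> * \<gamma>" using F' assms(3) by (simp add: power2_eq_square)
  show ?thesis
  proof (cases "\<alpha> = 0")
    case False
    have "veronese a\<^sub>0 a\<^sub>1 a\<^sub>2 (vector [\<alpha>, \<beta>]) = \<alpha> *s x"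
      unfolding x veronese_def
      by (simp add: power2_eq_square \<beta> vec.scale_right_distrib vector_smult_assoc)
    moreover have "vector [\<alpha>, \<beta>] \<noteq> (0 :: complex ^ 2)" using False by (simp add: vec_eq_iff forall_2)
    ultimately show ?thesis using False by blast
  next
    case True
    with \<beta> have "\<beta> = 0" by simp
    with True x assms(4) have \<gamma>: "\<gamma> \<noteq> 0" by auto
    have "veronese a\<^sub>0 a\<^sub>1 a\<^sub>2 (vector [0, \<gamma>]) = \<gamma> *s x"
      unfolding x veronese_def using True \<open>\<beta> = 0\<close>
      by (simp add: power2_eq_square vector_smult_assoc)
    moreover have "vector [0, \<gamma>] \<noteq> (0 :: complex ^ 2)" using \<gamma> by (simp add: vec_eq_iff forall_2)
    ultimately show ?thesis using \<gamma> by blast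
  qed
qed

lemma frame_veronese_inj:
  assumes F: "frame k a\<^sub>0 a\<^sub>1 a\<^sub>2" and "v \<noteq> 0" "w \<noteq> 0" "c \<noteq> 0"
    and eq: "veronese a\<^sub>0 a\<^sub>1 a\<^sub>2 w = c *s veronese a\<^sub>0 a\<^sub>1 a\<^sub>2 v"
  shows "\<exists>d. d \<noteq> 0 \<and> w = d *s v"
proof -
  have k: "k \<noteq> 0" using F by (simp add: frame_def)
  have "B y (veronese a\<^sub>0 a\<^sub>1 a\<^sub>2 w) = c * B y (veronese a\<^sub>0 a\<^sub>1 a\<^sub>2 v)" for y
    unfolding eq by (simp add: B_linear)
  from this[of a\<^sub>0] this[of a\<^sub>1] this[of a\<^sub>2] k
  have *: "w $ 2 * w $ 2 = c * (v $ 2 * v $ 2)" "w $ 1 * w $ 2 = c * (v $ 1 * v $ 2)"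
    "w $ 1 * w $ 1 = c * (v $ 1 * v $ 1)"
    by (auto simp: frame_veronese[OF F] power2_eq_square)
  consider "w $ 1 \<noteq> 0" | "w $ 2 \<noteq> 0" using assms(3) by (auto simp: vec_eq_iff forall_2)
  then show ?thesis
  proof cases
    case 1
    with * have "v $ 1 \<noteq> 0" by auto
    with 1 * assms(4) show ?thesis
      by (intro exI[of _ "c * v $ 1 / w $ 1"]) (auto simp: vec_eq_iff forall_2 field_simps)
  next
    case 2
    with * have "v $ 2 \<noteq> 0" by auto
    with 2 * assms(4) show ?thesis
      by (intro exI[of _ "c * v $ 2 / w $ 2"]) (auto simp: vec_eq_iff forall_2 field_simps)
  qed
qed

text \<open>A line contained in the conic would be a totally isotropic plane in a nondegenerate space of
  dimension three; some vector of such a plane would be orthogonal to everything.\<close>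

lemma isotropic_independent:
  assumes "h a = 0" "B a a = 0" "h c = 0" "B c c = 0"
    and indep: "\<And>\<alpha> \<gamma>. \<alpha> *s a + \<gamma> *s c = 0 \<Longrightarrow> \<alpha> = 0 \<and> \<gamma> = 0"
  shows "B a c \<noteq> 0"
proof
  assume ac: "B a c = 0"
  have "a \<noteq> 0" using indep[of 1 0] by auto
  then obtain y where y: "h y = 0" "B a y \<noteq> 0" using nondegenerate assms(1) by blast
  \<comment> \<open>A combination of \<open>a\<close> and \<open>c\<close> that is orthogonal to \<open>y\<close> as well.\<close>
  define c' where "c' = c - (B c y / B a y) *s a"
  have c': "h c' = 0" "B c' a = 0" "B c' c = 0" "B c' y = 0"
    using assms ac y by (simp_all add: c'_def h_linear B_linear B_sym[of c a])
  have "c' \<noteq> 0"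
  proof
    assume "c' = 0"
    then have "(- (B c y / B a y)) *s a + 1 *s c = 0" by (simp add: c'_def)
    then show False using indep by fastforce
  qed
  then obtain z where z: "h z = 0" "B c' z \<noteq> 0" using nondegenerate c'(1) by blast
  have "\<exists>\<alpha> \<beta> \<gamma>. z = \<alpha> *s a + \<beta> *s y + \<gamma> *s c"
  proof (rule plane_spanned)
    fix \<alpha> \<beta> \<gamma> assume 0: "\<alpha> *s a + \<beta> *s y + \<gamma> *s c = 0"
    have "B a (\<alpha> *s a + \<beta> *s y + \<gamma> *s c) = 0" unfolding 0 by (simp add: B_linear)
    then have "\<beta> = 0" using assms ac y by (simp add: B_linear)
    with 0 indep[of \<alpha> \<gamma>] show "\<alpha> = 0 \<and> \<beta> = 0 \<and> \<gamma> = 0" by simp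
  qed (use assms y z in auto)
  then show False using z c' by (auto simp: B_linear)
qed

text \<open>The middle vector is the pole of the line through \<open>a\<close> and \<open>c\<close>; it is not isotropic since
  otherwise it would be orthogonal to the whole plane.\<close>

lemma frame_through_vectors:
  assumes "h a = 0" "B a a = 0" "h c = 0" "B c c = 0"
    and indep: "\<And>\<alpha> \<gamma>. \<alpha> *s a + \<gamma> *s c = 0 \<Longrightarrow> \<alpha> = 0 \<and> \<gamma> = 0"
  shows "\<exists>k b. frame k a b c"
proof -
  have k: "B a c \<noteq> 0" by (rule isotropic_independent[OF assms])
  obtain b where b: "b \<noteq> 0" "h b = 0" "B a b = 0" "B c b = 0"
    using three_linear_forms_common_zero[OF form_h form_B form_B] by blast
  have "B b b \<noteq> 0"
  proof
    assume bb: "B b b = 0"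
    obtain z where z: "h z = 0" "B b z \<noteq> 0" using nondegenerate b by blast
    have "\<exists>\<alpha> \<beta> \<gamma>. z = \<alpha> *s a + \<beta> *s b + \<gamma> *s c"
    proof (rule plane_spanned)
      fix \<alpha> \<beta> \<gamma> assume 0: "\<alpha> *s a + \<beta> *s b + \<gamma> *s c = 0"
      have "B x (\<alpha> *s a + \<beta> *s b + \<gamma> *s c) = 0" for x unfolding 0 by (simp add: B_linear)
      from this[of a] this[of c] have "\<gamma> = 0" "\<alpha> = 0"
        using assms b k by (simp_all add: B_linear B_sym[of c a])
      with 0 b(1) show "\<alpha> = 0 \<and> \<beta> = 0 \<and> \<gamma> = 0" by simp
    qed (use assms b z in auto)
    then show False using z b bb by (auto simp: B_linear B_sym[of b a] B_sym[of b c])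
  qed
  moreover define r where "r = csqrt (- 2 * B a c / B b b)"
  ultimately have "r * (r * B b b) = - 2 * B a c"
    using power2_csqrt[of "- 2 * B a c / B b b"]
    by (simp add: power2_eq_square mult.assoc[symmetric])
  then have "frame (B a c) a (r *s b) c"
    using assms b k by (simp add: frame_def h_linear B_linear B_sym[of b c])
  then show ?thesis by blast
qed

lemma frame_through_points:
  assumes "p \<in> C" "q \<in> C" "p \<noteq> q"
  shows "\<exists>k b. frame k (rep_proj p) b (rep_proj q)"
  using assms(1,2) distinct_points_independent[OF assms(3)]
  by (intro frame_through_vectors) (auto simp: conic_eq)

text \<open>A line through \<open>p\<close> in the plane that is not the tangent meets the conic in a second point.\<close>

lemma second_point:
  assumes "p \<in> C"
  shows "\<exists>q\<in>C. q \<noteq> p"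
proof -
  define a where "a = rep_proj p"
  have a: "h a = 0" "B a a = 0" "a \<noteq> 0" "p = abs_proj a"
    using assms rep_proj_nonzero[of p] by (auto simp: a_def conic_eq)
  obtain w where w: "h w = 0" "B a w \<noteq> 0" using nondegenerate a by blast
  define c where "c = w - (B w w / (2 * B a w)) *s a"
  have c: "h c = 0" "B c c = 0" "B a c \<noteq> 0"
    using a w by (simp_all add: c_def h_linear B_linear B_sym[of w a] field_simps)
  have "c \<noteq> 0" using c by (auto simp: B_linear)
  moreover have "abs_proj c \<noteq> abs_proj a"
  proof
    assume "abs_proj c = abs_proj a"
    then obtain d where "c = d *s a"
      using abs_proj_eqD[of a c] \<open>c \<noteq> 0\<close> a by metis
    with a c show False by (simp add: B_linear)
  qed
  ultimately show ?thesis using a c abs_proj_in_conic[of c] by blast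
qed

lemma frame_through_point:
  assumes "p \<in> C"
  shows "\<exists>k b c. frame k (rep_proj p) b c"
  using second_point[OF assms] frame_through_points[OF assms] by metis

lemma frame_exists: "\<exists>k a b c. frame k a b c"
proof -
  obtain x where "x \<noteq> 0" "h x = 0" "B x x = 0" using isotropic_vector_exists[OF form_h form_B B_sym] by blast
  then have "abs_proj x \<in> C" by (simp add: abs_proj_in_conic)
  then show ?thesis using frame_through_point by blast
qed

text \<open>The images of the parameters \<open>[1:0]\<close>, \<open>[0:1]\<close> and \<open>[1:1]\<close> span the plane.\<close>

lemma linear_span_conic: "linear_span C = {x. h x = 0}"
proof
  have "vec.subspace {x. h x = 0}"
    by (auto simp: vec.subspace_def h_linear)
  moreover have "rep_proj ` C \<subseteq> {x. h x = 0}" by (auto simp: conic_eq)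
  ultimately show "linear_span C \<subseteq> {x. h x = 0}"
    unfolding linear_span_def by (rule vec.span_minimal[rotated])
next
  obtain k a b c where F: "frame k a b c" using frame_exists by blast
  have span: "veronese a b c v \<in> linear_span C" if "v \<noteq> 0" for v
  proof -
    have nz: "veronese a b c v \<noteq> 0" by (rule frame_veronese_nonzero[OF F that])
    then have "abs_proj (veronese a b c v) \<in> C"
      by (simp add: abs_proj_in_conic frame_veronese[OF F])
    then have "rep_proj (abs_proj (veronese a b c v)) \<in> linear_span C"
      unfolding linear_span_def by (intro vec.span_base imageI)
    moreover obtain l where l: "l \<noteq> 0" "rep_proj (abs_proj (veronese a b c v)) = l *s veronese a b c v"
      using rep_abs_proj[OF nz] by blast
    ultimately have "inverse l *s (l *s veronese a b c v) \<in> linear_span C"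
      unfolding linear_span_def by (metis vec.span_scale)
    with l(1) show ?thesis by (simp add: vector_smult_assoc)
  qed
  have "veronese a b c (vector [1, 0]) = a" "veronese a b c (vector [0, 1]) = c"
    "veronese a b c (vector [1, 1]) = a + b + c"
    by (simp_all add: veronese_def)
  moreover have "vector [1, 0] \<noteq> (0 :: complex ^ 2)" "vector [0, 1] \<noteq> (0 :: complex ^ 2)"
    "vector [1, 1] \<noteq> (0 :: complex ^ 2)" by (simp_all add: vec_eq_iff forall_2)
  ultimately have *: "a \<in> linear_span C" "c \<in> linear_span C" "a + b + c \<in> linear_span C"
    using span by metis+
  have "b = (a + b + c) - a - c" by simp
  then have "b \<in> linear_span C" using * unfolding linear_span_def by (metis vec.span_diff)
  with * have "\<alpha> *s a + \<beta> *s b + \<gamma> *s c \<in> linear_span C" for \<alpha> \<beta> \<gamma>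
    unfolding linear_span_def by (intro vec.span_add vec.span_scale)
  then show "{x. h x = 0} \<subseteq> linear_span C"
    using frame_expansion[OF F] by (metis (mono_tags, lifting) mem_Collect_eq subsetI)
qed

end

lemma differential_linear: "form 1 h \<Longrightarrow> differential h v w = h w"
  unfolding differential_def
  by (rule DERIV_imp_deriv) (auto simp: form_1_linear intro!: derivative_eq_intros)

lemma differential_quadratic:
  assumes B: "\<And>x. form 1 (B x)" and sym: "\<And>x y. B x y = B y x"
  shows "differential (\<lambda>x. B x x) v w = 2 * B v w"
proof -
  have left: "B (x + y) z = B x z + B y z" "B (c *s x) z = c * B x z" for x y z c
    using form_1_linear[OF B] by (simp_all add: sym[of _ z])
  have "B (v + t *s w) (v + t *s w) = B v v + 2 * t * B v w + t * t * B w w" for t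
    by (simp add: left form_1_linear[OF B] sym[of w v] algebra_simps)
  then show ?thesis unfolding differential_def
    by (intro DERIV_imp_deriv) (auto intro!: derivative_eq_intros)
qed

text \<open>The differential of \<open>Q\<close> at \<open>x\<close> is \<open>2 B x\<close>. If \<open>B x\<close> vanished on the plane \<open>h = 0\<close> for some \<open>x\<close> in it,
  then \<open>x\<close> would be a point of the conic, and \<open>B x\<close> would be a multiple of \<open>h\<close>, against the
  Jacobian criterion.\<close>

lemma smooth_conic_plane_conic:
  assumes "smooth_conic C"
  shows "\<exists>h B. plane_conic C h B"
proof -
  from assms obtain h Q where h: "form 1 h" and Q: "form 2 Q"
    and C: "C = {p. zero_at h p \<and> zero_at Q p}"
    and smooth: "\<And>p a b. p \<in> C \<Longrightarrow>
      (\<And>w. a * differential h (rep_proj p) w + b * differential Q (rep_proj p) w = 0) \<Longrightarrow> a = 0 \<and> b = 0"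
    unfolding smooth_conic_def by blast
  obtain B where QB: "\<And>x. Q x = B x x" and sym: "\<And>x y. B x y = B y x" and B: "\<And>x. form 1 (B x)"
    using form_2_polarization[OF Q] by blast
  have Q_eq: "Q = (\<lambda>x. B x x)" using QB by (rule ext)
  have left: "B (x + y) z = B x z + B y z" "B (c *s x) z = c * B x z" for x y z c
    using form_1_linear[OF B] by (simp_all add: sym[of _ z])
  have smooth': "a = 0 \<and> b = 0"
    if x: "x \<noteq> 0" "h x = 0" "B x x = 0" and ab: "\<And>w. a * h w + b * (2 * B x w) = 0" for x a b
  proof -
    obtain c where c: "c \<noteq> 0" "rep_proj (abs_proj x) = c *s x" using rep_abs_proj[OF x(1)] by blast
    have "abs_proj x \<in> C" using x by (simp add: C zero_at_abs_proj[OF h] zero_at_abs_proj[OF Q] QB)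
    moreover have "a * differential h (rep_proj (abs_proj x)) w
        + (b / c) * differential Q (rep_proj (abs_proj x)) w = 0" for w
      using ab[of w] c by (simp add: Q_eq differential_linear[OF h] differential_quadratic[OF B sym] left)
    ultimately have "a = 0 \<and> b / c = 0" by (rule smooth)
    with c(1) show ?thesis by simp
  qed
  have h_nz: "\<exists>e. h e \<noteq> 0"
  proof (rule ccontr)
    assume "\<not> (\<exists>e. h e \<noteq> 0)"
    moreover obtain x where "x \<noteq> 0" "h x = 0" "B x x = 0"
      using isotropic_vector_exists[OF h B sym] by blast
    ultimately show False using smooth'[of x 1 0] by simp
  qed
  have "plane_conic C h B"
  proof
    show "C = {p. h (rep_proj p) = 0 \<and> B (rep_proj p) (rep_proj p) = 0}"
      by (simp add: C zero_at_def QB)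
    show "form 2 (\<lambda>x. B x x)" using Q by (simp add: Q_eq)
    fix x assume x: "h x = 0" "x \<noteq> 0"
    show "\<exists>y. h y = 0 \<and> B x y \<noteq> 0"
    proof (rule ccontr)
      assume neg: "\<not> (\<exists>y. h y = 0 \<and> B x y \<noteq> 0)"
      obtain e where e: "h e \<noteq> 0" using h_nz by blast
      have "B x w = (h w / h e) * B x e" for w
      proof -
        have "h (w - (h w / h e) *s e) = 0" using e by (simp add: form_1_linear[OF h])
        then have "B x (w - (h w / h e) *s e) = 0" using neg by blast
        then show ?thesis by (simp add: form_1_linear[OF B])
      qed
      then have "B x w * h e = h w * B x e" for w using e by (metis nonzero_eq_divide_eq times_divide_eq_left)
      then have "(- (2 * B x e / h e)) * h w + 1 * (2 * B x w) = 0" for w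
        using e by (simp add: field_simps)
      moreover have "B x x = 0" using neg x(1) by blast
      ultimately have "- (2 * B x e / h e) = 0 \<and> (1 :: complex) = 0"
        using x by (intro smooth') 
      then show False by simp
    qed
  qed (fact h h_nz B sym)+
  then show ?thesis by blast
qed

context plane_conic
begin

text \<open>The equations \<open>h\<close> and \<open>Q\<close> bound the tangent space from above. Conversely, in a frame with first vector
  \<open>p\<close> the vectors satisfying both equations are \<open>\<alpha> a + \<beta> b\<close>, and each of them is the velocity of a
  curve on the cone over the conic, along which every form in the ideal of the conic is zero.\<close>

lemma tangent_space_conic:
  assumes p: "p \<in> C"
  shows "y \<in> tangent_space C p \<longleftrightarrow> h (rep_proj y) = 0 \<and> B (rep_proj p) (rep_proj y) = 0"
proof
  assume y: "y \<in> tangent_space C p"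
  have "differential h (rep_proj p) (rep_proj y) = 0"
    using y form_h by (auto simp: tangent_space_def conic_eq zero_at_def)
  moreover have "differential (\<lambda>x. B x x) (rep_proj p) (rep_proj y) = 0"
    using y form_Q by (auto simp: tangent_space_def conic_eq zero_at_def)
  ultimately show "h (rep_proj y) = 0 \<and> B (rep_proj p) (rep_proj y) = 0"
    by (simp add: differential_linear[OF form_h] differential_quadratic[OF form_B B_sym])
next
  assume y: "h (rep_proj y) = 0 \<and> B (rep_proj p) (rep_proj y) = 0"
  obtain k b c where F: "frame k (rep_proj p) b c" using frame_through_point[OF p] by blast
  define a where "a = rep_proj p"
  note F = F[folded a_def]
  have Ba: "B a (rep_proj y) = 0" using y by (simp add: a_def)
  obtain \<alpha> \<beta> where y_eq: "rep_proj y = \<alpha> *s a + \<beta> *s b"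
    using frame_expansion[OF F, of "rep_proj y", unfolded Ba div_0 vec.scale_zero_left add_0_right] y
    by blast
  have "differential G (rep_proj p) (rep_proj y) = 0"
    if G: "form d G" and vanish: "\<forall>x\<in>C. zero_at G x" for d G
  proof -
    \<comment> \<open>The factor \<open>exp (\<alpha> t / 2)\<close> contributes the radial part \<open>\<alpha> a\<close> of the velocity without ever being zero.\<close>
    define \<gamma> where "\<gamma> t = veronese a b c (vector [exp (\<alpha> * t / 2), \<beta> * t * exp (\<alpha> * t / 2)])" for t
    obtain D where D: "\<And>\<gamma>. (\<And>i. ((\<lambda>t. \<gamma> t $ i) has_field_derivative rep_proj y $ i) (at 0)) \<Longrightarrow> \<gamma> 0 = a
        \<Longrightarrow> ((\<lambda>t. G (\<gamma> t)) has_field_derivative D) (at 0)"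
      using form_along_curve[OF G, of "rep_proj y" a] by metis
    have "((\<lambda>t. G (a + t *s rep_proj y)) has_field_derivative D) (at 0)"
      by (rule D) (auto intro!: derivative_eq_intros)
    moreover have "((\<lambda>t. G (\<gamma> t)) has_field_derivative D) (at 0)"
      by (rule D) (auto simp: \<gamma>_def veronese_def y_eq intro!: derivative_eq_intros)
    moreover have "G (\<gamma> t) = 0" for t
    proof -
      have "vector [exp (\<alpha> * t / 2), \<beta> * t * exp (\<alpha> * t / 2)] \<noteq> (0 :: complex ^ 2)"
        by (simp add: vec_eq_iff forall_2)
      then have nz: "\<gamma> t \<noteq> 0" unfolding \<gamma>_def by (rule frame_veronese_nonzero[OF F])
      then have "abs_proj (\<gamma> t) \<in> C"
        by (simp add: abs_proj_in_conic) (simp add: \<gamma>_def frame_veronese[OF F])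
      with vanish have "zero_at G (abs_proj (\<gamma> t))" by blast
      then show ?thesis by (simp only: zero_at_abs_proj[OF G nz])
    qed
    ultimately have "D = 0"
      using DERIV_unique[of "\<lambda>_. 0 :: complex" D 0 0] by simp
    with \<open>((\<lambda>t. G (a + t *s rep_proj y)) has_field_derivative D) (at 0)\<close> show ?thesis
      unfolding differential_def a_def by (simp add: DERIV_imp_deriv)
  qed
  then show "y \<in> tangent_space C p" unfolding tangent_space_def by blast
qed

lemma abs_proj_veronese_rep:
  assumes "frame k a b c" "v \<noteq> 0"
  shows "abs_proj (veronese a b c (rep_proj (abs_proj v))) = abs_proj (veronese a b c v)"
proof -
  obtain l where "l \<noteq> 0" "rep_proj (abs_proj v) = l *s v" using rep_abs_proj[OF assms(2)] by blast
  then show ?thesis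
    by (simp add: veronese_scale abs_proj_scale frame_veronese_nonzero[OF assms])
qed

text \<open>The inverse sends \<open>\<alpha> a + \<beta> b + \<gamma> c\<close> to \<open>[\<alpha> : \<beta>] = [\<beta> : \<gamma>]\<close>, where at each point of the conic at least
  one of the two descriptions is defined. The coordinates are, up to factors, the products with
  the vectors of the frame.\<close>

lemma frame_parametrization_isomorphism:
  assumes F: "frame k a b c"
  shows "isomorphism (UNIV :: 2 proj set) C (\<lambda>x. abs_proj (veronese a b c (rep_proj x)))"
proof -
  define \<phi> where "\<phi> = (\<lambda>x :: 2 proj. abs_proj (veronese a b c (rep_proj x)))"
  note nz = frame_veronese_nonzero[OF F]
  note k = F[unfolded frame_def, THEN conjunct1]
  have inj: "inj \<phi>"
  proof (rule injI)
    fix x y assume "\<phi> x = \<phi> y"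
    then obtain m where m: "m \<noteq> 0" "veronese a b c (rep_proj y) = m *s veronese a b c (rep_proj x)"
      using abs_proj_eqD nz rep_proj_nonzero unfolding \<phi>_def by metis
    then obtain d where "d \<noteq> 0" "rep_proj y = d *s rep_proj x"
      using frame_veronese_inj[OF F rep_proj_nonzero rep_proj_nonzero] by metis
    then show "x = y" by (metis abs_proj_scale abs_rep_proj rep_proj_nonzero)
  qed
  have rep: "\<exists>v m. v \<noteq> 0 \<and> m \<noteq> 0 \<and> rep_proj p = m *s veronese a b c v \<and> \<phi> (abs_proj v) = p" if "p \<in> C" for p
  proof -
    have "h (rep_proj p) = 0" "B (rep_proj p) (rep_proj p) = 0" using that by (simp_all add: conic_eq)
    then obtain v m where v: "v \<noteq> 0" "m \<noteq> 0" "veronese a b c v = m *s rep_proj p"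
      using frame_veronese_surj[OF F] rep_proj_nonzero[of p] by blast
    then have "\<phi> (abs_proj v) = p"
      by (simp add: \<phi>_def abs_proj_veronese_rep[OF F] abs_proj_scale rep_proj_nonzero)
    moreover have "rep_proj p = inverse m *s veronese a b c v"
      using v(2) unfolding v(3) by (simp add: vector_smult_assoc)
    moreover have "inverse m \<noteq> 0" using v(2) by simp
    ultimately show ?thesis using v(1) by blast
  qed
  have "\<phi> x \<in> C" for x
    using nz[OF rep_proj_nonzero] by (simp add: \<phi>_def abs_proj_in_conic frame_veronese[OF F])
  then have bij: "bij_betw \<phi> UNIV C"
    using inj rep by (force simp: bij_betw_def)
  have "form 2 (\<lambda>v. veronese a b c v $ i)" for i
    by (rule form_linear_veronese[OF form_component])
  then have reg: "regular_on UNIV \<phi>"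
    unfolding regular_on_def \<phi>_def
    by (intro ballI exI[of _ 0] exI[of _ "\<lambda>_. 1"] exI[of _ 2] exI[of _ "veronese a b c"])
       (auto simp: form_const zero_at_def nz rep_proj_nonzero)
  have "regular_on C (inv_into UNIV \<phi>)"
    unfolding regular_on_def
  proof
    fix p assume p: "p \<in> C"
    define F\<^sub>1 where "F\<^sub>1 x = (vector [B c x / k, - B b x / (2 * k)] :: complex ^ 2)" for x
    define F\<^sub>2 where "F\<^sub>2 x = (vector [- B b x / (2 * k), B a x / k] :: complex ^ 2)" for x
    have "form 1 (\<lambda>x. inverse k * B y x)" "form 1 (\<lambda>x. (- inverse (2 * k)) * B y x)" for y
      by (rule form_cmult[OF form_B])+
    then have forms: "form 1 (\<lambda>x. F\<^sub>1 x $ i)" "form 1 (\<lambda>x. F\<^sub>2 x $ i)" for i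
      using exhaust_2[of i] by (auto simp: F\<^sub>1_def F\<^sub>2_def field_simps)
    have F\<^sub>1: "F\<^sub>1 (rep_proj q) \<noteq> 0 \<and> inv_into UNIV \<phi> q = abs_proj (F\<^sub>1 (rep_proj q))"
      if q: "q \<in> C" "\<not> zero_at (B c) q" for q
    proof -
      obtain v m where v: "v \<noteq> 0" "m \<noteq> 0" "rep_proj q = m *s veronese a b c v" "\<phi> (abs_proj v) = q"
        using rep[OF q(1)] by blast
      have "F\<^sub>1 (rep_proj q) = (m * v $ 1) *s v"
        using k by (simp add: F\<^sub>1_def v B_linear frame_veronese[OF F] vec_eq_iff forall_2 power2_eq_square)
      moreover have "v $ 1 \<noteq> 0" using q(2) by (auto simp: zero_at_def v B_linear frame_veronese[OF F])
      ultimately show ?thesis using v inj by (auto simp: abs_proj_scale inv_f_f)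
    qed
    have F\<^sub>2: "F\<^sub>2 (rep_proj q) \<noteq> 0 \<and> inv_into UNIV \<phi> q = abs_proj (F\<^sub>2 (rep_proj q))"
      if q: "q \<in> C" "\<not> zero_at (B a) q" for q
    proof -
      obtain v m where v: "v \<noteq> 0" "m \<noteq> 0" "rep_proj q = m *s veronese a b c v" "\<phi> (abs_proj v) = q"
        using rep[OF q(1)] by blast
      have "F\<^sub>2 (rep_proj q) = (m * v $ 2) *s v"
        using k by (simp add: F\<^sub>2_def v B_linear frame_veronese[OF F] vec_eq_iff forall_2 power2_eq_square)
      moreover have "v $ 2 \<noteq> 0" using q(2) by (auto simp: zero_at_def v B_linear frame_veronese[OF F])
      ultimately show ?thesis using v inj by (auto simp: abs_proj_scale inv_f_f)
    qed
    obtain v m where v: "v \<noteq> 0" "m \<noteq> 0" "rep_proj p = m *s veronese a b c v"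
      using rep[OF p] by blast
    have "v $ 1 \<noteq> 0 \<or> v $ 2 \<noteq> 0" using v(1) by (auto simp: vec_eq_iff forall_2)
    then have "\<not> zero_at (B c) p \<or> \<not> zero_at (B a) p"
      using k v(2) by (auto simp: zero_at_def v(3) B_linear frame_veronese[OF F])
    then show "\<exists>e G d F. form e G \<and> (\<forall>i. form d (\<lambda>v. F v $ i)) \<and> \<not> zero_at G p \<and>
        (\<forall>y\<in>C. \<not> zero_at G y \<longrightarrow> F (rep_proj y) \<noteq> 0 \<and> inv_into UNIV \<phi> y = abs_proj (F (rep_proj y)))"
    proof
      assume "\<not> zero_at (B c) p"
      then show ?thesis using form_B forms F\<^sub>1
        by (intro exI[of _ 1] exI[of _ "B c"] exI[of _ F\<^sub>1]) blast
    next
      assume "\<not> zero_at (B a) p"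
      then show ?thesis using form_B forms F\<^sub>2
        by (intro exI[of _ 1] exI[of _ "B a"] exI[of _ F\<^sub>2]) blast
    qed
  qed
  with bij reg show ?thesis unfolding isomorphism_def \<phi>_def by simp
qed

end

section \<open>Isomorphisms from the line to a conic\<close>

lemma cofinite_polynomial_identity:
  fixes f g :: "complex poly"
  assumes "finite S" and "\<And>z. z \<notin> S \<Longrightarrow> poly f z = poly g z"
  shows "f = g"
proof (rule ccontr)
  assume "f \<noteq> g"
  then have "finite {z. poly (f - g) z = 0}" by (intro poly_roots_finite) simp
  moreover have "UNIV = S \<union> {z. poly (f - g) z = 0}" using assms(2) by auto
  ultimately have "finite (UNIV :: complex set)" using assms(1) by (metis finite_UnI)
  then show False using infinite_UNIV_char_0 by blast
qed

text \<open>A function that is a quotient of polynomials near every point is one quotient \<open>f / g\<close> everywhere,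
  since an identity of polynomials outside a finite set extends to all points. A root of \<open>g\<close> is a root
  of \<open>f = r g\<close>, too, and can be cancelled; when no root is left, \<open>g\<close> is constant.\<close>

lemma locally_rational_imp_polynomial:
  fixes r :: "complex \<Rightarrow> complex"
  assumes local: "\<And>z\<^sub>0. \<exists>f g G. poly G z\<^sub>0 \<noteq> 0 \<and>
     (\<forall>z. poly G z \<noteq> 0 \<longrightarrow> poly g z \<noteq> 0 \<and> r z * poly g z = poly f z)"
  shows "\<exists>p. \<forall>z. r z = poly p z"
proof -
  \<comment> \<open>Cross-multiplying with the quotient valid near \<open>z\<^sub>0\<close> gives an identity of polynomials.\<close>
  have extend: "r z\<^sub>0 * poly g z\<^sub>0 = poly f z\<^sub>0"
    if S: "finite S" "\<And>z. z \<notin> S \<Longrightarrow> r z * poly g z = poly f z" for f g S z\<^sub>0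
  proof -
    obtain f\<^sub>1 g\<^sub>1 G where G: "poly G z\<^sub>0 \<noteq> 0"
      "\<And>z. poly G z \<noteq> 0 \<Longrightarrow> poly g\<^sub>1 z \<noteq> 0 \<and> r z * poly g\<^sub>1 z = poly f\<^sub>1 z"
      using local[of z\<^sub>0] by blast
    have "finite (S \<union> {z. poly G z = 0})" using G(1) S(1) by (auto intro: poly_roots_finite)
    then have "f\<^sub>1 * g = f * g\<^sub>1"
    proof (rule cofinite_polynomial_identity)
      fix z assume "z \<notin> S \<union> {z. poly G z = 0}"
      then have "r z * poly g z = poly f z" "r z * poly g\<^sub>1 z = poly f\<^sub>1 z" using S(2) G(2) by auto
      then show "poly (f\<^sub>1 * g) z = poly (f * g\<^sub>1) z" by (metis mult.assoc mult.commute poly_mult)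
    qed
    then have "poly f\<^sub>1 z\<^sub>0 * poly g z\<^sub>0 = poly f z\<^sub>0 * poly g\<^sub>1 z\<^sub>0" by (metis poly_mult)
    moreover have "poly g\<^sub>1 z\<^sub>0 \<noteq> 0" "r z\<^sub>0 * poly g\<^sub>1 z\<^sub>0 = poly f\<^sub>1 z\<^sub>0" using G by auto
    moreover have "poly g\<^sub>1 z\<^sub>0 * (r z\<^sub>0 * poly g z\<^sub>0) = (r z\<^sub>0 * poly g\<^sub>1 z\<^sub>0) * poly g z\<^sub>0" by simp
    ultimately have "poly g\<^sub>1 z\<^sub>0 * (r z\<^sub>0 * poly g z\<^sub>0) = poly g\<^sub>1 z\<^sub>0 * poly f z\<^sub>0" by simp
    with \<open>poly g\<^sub>1 z\<^sub>0 \<noteq> 0\<close> show ?thesis by simp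
  qed
  have reduce: "\<exists>p. \<forall>z. r z = poly p z" if "g \<noteq> 0" "\<And>z. r z * poly g z = poly f z" for f g
    using that
  proof (induction "degree g" arbitrary: f g rule: less_induct)
    case less
    show ?case
    proof (cases "degree g = 0")
      case True
      then obtain c where c: "g = [:c:]" by (rule degree_eq_zeroE)
      with less(2) have "c \<noteq> 0" by simp
      then have "r z = poly (smult (1 / c) f) z" for z using less(3)[of z] c by (simp add: field_simps)
      then show ?thesis by blast
    next
      case False
      then have "\<not> constant (poly g)" by (simp add: constant_degree)
      then obtain a where a: "poly g a = 0" using fundamental_theorem_of_algebra by blast
      then have "poly f a = 0" using less(3)[of a] by simp
      with a obtain f' g' where eq: "f = [:- a, 1:] * f'" "g = [:- a, 1:] * g'"
        unfolding poly_eq_0_iff_dvd dvd_def by blast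
      have "g' \<noteq> 0" using eq less(2) by auto
      then have "degree g' < degree g" unfolding eq by (subst degree_mult_eq) auto
      moreover have "r z * poly g' z = poly f' z" for z
      proof (rule extend[of "{a}"])
        fix z assume "z \<notin> {a}"
        moreover have "(z - a) * (r z * poly g' z) = (z - a) * poly f' z"
          using less(3)[of z] by (simp add: eq algebra_simps)
        ultimately show "r z * poly g' z = poly f' z" by simp
      qed simp
      ultimately show ?thesis using less(1) \<open>g' \<noteq> 0\<close> by blast
    qed
  qed
  obtain f g G where G: "poly G 0 \<noteq> 0"
      "\<And>z. poly G z \<noteq> 0 \<Longrightarrow> poly g z \<noteq> 0 \<and> r z * poly g z = poly f z"
    using local[of 0] by blast
  have "finite {z. poly G z = 0}" using G(1) by (auto intro: poly_roots_finite)
  then have "r z * poly g z = poly f z" for z by (rule extend) (use G(2) in auto)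
  moreover have "g \<noteq> 0" using G by auto
  ultimately show ?thesis using reduce by blast
qed

text \<open>For a value \<open>c\<close> that is not attained at a zero of the derivative, \<open>p - c\<close> has as many roots as its
  degree.\<close>

lemma injective_polynomial_degree:
  fixes p :: "complex poly"
  assumes "inj (poly p)"
  shows "degree p \<le> 1"
proof (rule ccontr)
  assume deg: "\<not> degree p \<le> 1"
  then have "pderiv p \<noteq> 0" by (auto simp: pderiv_eq_0_iff)
  then have "finite (poly p ` {z. poly (pderiv p) z = 0})" by (intro finite_imageI poly_roots_finite)
  then obtain c where c: "c \<notin> poly p ` {z. poly (pderiv p) z = 0}"
    using ex_new_if_finite[OF infinite_UNIV_char_0] by blast
  define q where "q = p - [:c:]"
  have q_roots: "poly q z = 0 \<longleftrightarrow> poly p z = c" for z by (auto simp: q_def)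
  have "pderiv q = pderiv p" by (simp add: q_def pderiv_diff)
  then have "rsquarefree q" using c by (auto simp: rsquarefree_roots q_roots)
  then have q_eq: "q = smult (lead_coeff q) (\<Prod>z|poly q z = 0. [:- z, 1:])"
    by (rule complex_poly_decompose_rsquarefree[symmetric])
  have "degree (\<Prod>z|poly q z = 0. [:- z, 1:]) = (\<Sum>z|poly q z = 0. degree [:- z, 1:])"
    by (rule degree_prod_eq_sum_degree) auto
  then have "degree q \<le> card {z. poly q z = 0}"
    by (subst q_eq) (simp add: degree_smult_eq)
  also have "finite {z. poly q z = 0}"
    using \<open>rsquarefree q\<close> by (intro poly_roots_finite) (simp add: rsquarefree_def)
  then have "card {z. poly q z = 0} \<le> 1"
    using assms by (simp add: card_le_Suc0_iff_eq q_roots inj_def)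
  finally have "degree q \<le> 1" .
  moreover have "degree q = degree p"
    using deg unfolding q_def diff_conv_add_uminus by (intro degree_add_eq_left) auto
  ultimately show False using deg by simp
qed

context plane_conic
begin

text \<open>Take a frame through the images of infinity and zero. In its coordinates the
  isomorphism is a map \<open>r\<close> of the affine line into itself that fixes zero, is injective and locally
  rational, hence is multiplication by a constant \<open>s\<close>. Rescaling the frame turns \<open>s\<close> into one.\<close>

lemma isomorphism_veronese:
  fixes \<phi> :: "2 proj \<Rightarrow> 4 proj"
  assumes iso: "isomorphism UNIV C \<phi>"
  shows "\<exists>k a b c. frame k a b c \<and> (\<forall>v. v \<noteq> 0 \<longrightarrow> \<phi> (abs_proj v) = abs_proj (veronese a b c v))"
proof -
  have inj: "inj \<phi>" and in_C: "\<phi> x \<in> C" for x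
    using iso by (auto simp: isomorphism_def bij_betw_def)
  define pt :: "complex \<Rightarrow> complex ^ 2" where "pt z = vector [z, 1]" for z
  define inf :: "complex ^ 2" where "inf = vector [1, 0]"
  have pt_nz: "pt z \<noteq> 0" for z by (simp add: pt_def vec_eq_iff forall_2)
  have inf_nz: "inf \<noteq> 0" by (simp add: inf_def vec_eq_iff forall_2)
  have pt_inf: "abs_proj (pt z) \<noteq> abs_proj inf" for z
  proof
    assume "abs_proj (pt z) = abs_proj inf"
    from abs_proj_eqD[OF this pt_nz inf_nz] show False
      by (auto simp: pt_def inf_def vec_eq_iff forall_2)
  qed
  have pt_inj: "z = w" if "abs_proj (pt z) = abs_proj (pt w)" for z w
    using abs_proj_eqD[OF that pt_nz pt_nz] by (auto simp: pt_def vec_eq_iff forall_2)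
  define a where "a = rep_proj (\<phi> (abs_proj inf))"
  define c where "c = rep_proj (\<phi> (abs_proj (pt 0)))"
  have "\<phi> (abs_proj inf) \<noteq> \<phi> (abs_proj (pt 0))" using inj pt_inf[of 0] by (metis injD)
  then obtain k b where F: "frame k a b c"
    using frame_through_points[OF in_C in_C] unfolding a_def c_def by blast
  note F' = F[unfolded frame_def]
  note nz = frame_veronese_nonzero[OF F]
  define y where "y z = rep_proj (\<phi> (abs_proj (pt z)))" for z
  \<comment> \<open>The quotient of the first two coordinates of the parameter of the point \<open>y z\<close>.\<close>
  define r where "r z = - B b (y z) / 2 / B a (y z)" for z
  have y: "B a (y z) \<noteq> 0 \<and> \<phi> (abs_proj (pt z)) = abs_proj (veronese a b c (pt (r z)))" for z
  proof -
    have "h (y z) = 0" "B (y z) (y z) = 0" "y z \<noteq> 0"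
      using in_C[of "abs_proj (pt z)"] rep_proj_nonzero by (auto simp: y_def conic_eq)
    then obtain v m where v: "v \<noteq> 0" "m \<noteq> 0" "veronese a b c v = m *s y z"
      using frame_veronese_surj[OF F] by blast
    have \<phi>_v: "\<phi> (abs_proj (pt z)) = abs_proj (veronese a b c v)"
      using v(2) by (simp add: v(3) y_def abs_proj_scale rep_proj_nonzero)
    have v2: "v $ 2 \<noteq> 0"
    proof
      assume v2: "v $ 2 = 0"
      then have "v $ 1 \<noteq> 0" using v(1) by (auto simp: vec_eq_iff forall_2)
      moreover have "a \<noteq> 0" by (simp add: a_def rep_proj_nonzero)
      ultimately have "abs_proj (veronese a b c v) = abs_proj a"
        using v2 by (simp add: veronese_def abs_proj_scale)
      with \<phi>_v have "\<phi> (abs_proj (pt z)) = \<phi> (abs_proj inf)" by (simp add: a_def)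
      then show False using inj pt_inf[of z] by (metis injD)
    qed
    have "m * B a (y z) = k * (v $ 2)\<^sup>2" "m * B b (y z) = - 2 * k * (v $ 1 * v $ 2)"
      using frame_veronese[OF F, of v] by (simp_all add: v(3) B_linear)
    then have B_y: "B a (y z) = k * (v $ 2)\<^sup>2 / m" "B b (y z) = - 2 * k * (v $ 1 * v $ 2) / m"
      using v(2) by (simp_all add: field_simps)
    then have "B a (y z) \<noteq> 0" using v2 v(2) F' by simp
    moreover have "r z = v $ 1 / v $ 2"
      unfolding r_def B_y using v2 v(2) F' by (simp add: power2_eq_square)
    then have "v = v $ 2 *s pt (r z)"
      using v2 by (simp add: pt_def vec_eq_iff forall_2)
    then have "abs_proj (veronese a b c v) = abs_proj (veronese a b c (pt (r z)))"
      using v2 by (metis veronese_scale abs_proj_scale nz pt_nz power_not_zero)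
    ultimately show ?thesis using \<phi>_v by simp
  qed
  have "inj r"
  proof (rule injI)
    fix z w assume "r z = r w"
    then have "\<phi> (abs_proj (pt z)) = \<phi> (abs_proj (pt w))" using y by simp
    then show "z = w" using inj pt_inj by (metis injD)
  qed
  moreover have "r 0 = 0" using F' by (simp add: r_def y_def c_def[symmetric])
  moreover have "\<exists>p. \<forall>z. r z = poly p z"
  proof (rule locally_rational_imp_polynomial)
    fix z\<^sub>0
    obtain e G d and F :: "complex ^ 2 \<Rightarrow> complex ^ 4" where
      G: "form e G" and F: "\<forall>i. form d (\<lambda>v. F v $ i)" and z\<^sub>0: "\<not> zero_at G (abs_proj (pt z\<^sub>0))"
      and \<phi>: "\<And>x. \<not> zero_at G x \<Longrightarrow> F (rep_proj x) \<noteq> 0 \<and> \<phi> x = abs_proj (F (rep_proj x))"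
      using iso unfolding isomorphism_def regular_on_def by blast
    have BF: "form d (\<lambda>v. B x (F v))" for x
      using form_compose[OF form_B F[rule_format]] by simp
    obtain pG where pG: "\<And>z. G (pt z) = poly pG z" using form_dehomogenize[OF G] unfolding pt_def by blast
    obtain pa where pa: "\<And>z. B a (F (pt z)) = poly pa z"
      using form_dehomogenize[OF BF] unfolding pt_def by blast
    obtain pb where pb: "\<And>z. B b (F (pt z)) = poly pb z"
      using form_dehomogenize[OF BF] unfolding pt_def by blast
    have "poly pa z \<noteq> 0 \<and> r z * poly pa z = poly (smult (- 1 / 2) pb) z" if "poly pG z \<noteq> 0" for z
    proof -
      have "\<not> zero_at G (abs_proj (pt z))" using that by (simp add: zero_at_abs_proj[OF G pt_nz] pG)
      note \<phi>_z = \<phi>[OF this]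
      obtain l where l: "rep_proj (abs_proj (pt z)) = l *s pt z" using rep_abs_proj[OF pt_nz] by blast
      obtain n where n: "n \<noteq> 0" "y z = n *s F (rep_proj (abs_proj (pt z)))"
        using rep_abs_proj \<phi>_z unfolding y_def by metis
      define N where "N = n * l ^ d"
      have "B x (y z) = N * B x (F (pt z))" for x
        unfolding n(2) l N_def using form_scale[OF BF] by (simp add: B_linear)
      then have *: "B a (y z) = N * poly pa z" "B b (y z) = N * poly pb z"
        by (simp_all add: pa pb)
      then have "N \<noteq> 0" "poly pa z \<noteq> 0" using y[of z] by auto
      then show ?thesis unfolding r_def * by (simp add: field_simps)
    qed
    moreover have "poly pG z\<^sub>0 \<noteq> 0" using z\<^sub>0 by (simp add: zero_at_abs_proj[OF G pt_nz] pG)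
    ultimately show "\<exists>f g G. poly G z\<^sub>0 \<noteq> 0 \<and>
        (\<forall>z. poly G z \<noteq> 0 \<longrightarrow> poly g z \<noteq> 0 \<and> r z * poly g z = poly f z)"
      by blast
  qed
  ultimately obtain p where p: "inj (poly p)" "\<And>z. r z = poly p z" "poly p 0 = 0"
    by (metis ext)
  have "coeff p n = 0" if "n > 1" for n
    using injective_polynomial_degree[OF p(1)] that by (intro coeff_eq_0) simp
  then have "p = [:coeff p 0, coeff p 1:]"
    by (intro poly_eqI) (auto simp: coeff_pCons split: nat.splits)
  then obtain t s where p_eq: "p = [:t, s:]" by blast
  have r: "r z = s * z" for z using p(2)[of z] p(3) by (simp add: p_eq)
  have s: "s \<noteq> 0" using \<open>inj r\<close> r by (metis injD mult_zero_left zero_neq_one)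
  have "frame (s\<^sup>2 * k) (s\<^sup>2 *s a) (s *s b) c"
    using F' s by (simp add: frame_def h_linear B_linear power2_eq_square)
  moreover have "\<phi> (abs_proj v) = abs_proj (veronese (s\<^sup>2 *s a) (s *s b) c v)" if "v \<noteq> 0" for v
  proof (cases "v $ 2 = 0")
    case True
    then have v1: "v $ 1 \<noteq> 0" using that by (auto simp: vec_eq_iff forall_2)
    then have "v = v $ 1 *s inf" using True by (simp add: inf_def vec_eq_iff forall_2)
    then have "abs_proj v = abs_proj inf" using v1 inf_nz by (metis abs_proj_scale)
    then have "\<phi> (abs_proj v) = abs_proj a" by (simp add: a_def)
    moreover have "veronese (s\<^sup>2 *s a) (s *s b) c v = ((v $ 1)\<^sup>2 * s\<^sup>2) *s a"
      using True by (simp add: veronese_def vector_smult_assoc)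
    moreover have "a \<noteq> 0" by (simp add: a_def rep_proj_nonzero)
    ultimately show ?thesis using v1 s by (simp add: abs_proj_scale)
  next
    case False
    define z where "z = v $ 1 / v $ 2"
    have v: "v = v $ 2 *s pt z" using False by (simp add: z_def pt_def vec_eq_iff forall_2)
    then have "abs_proj v = abs_proj (pt z)" using False pt_nz by (metis abs_proj_scale)
    then have "\<phi> (abs_proj v) = abs_proj (veronese a b c (pt (s * z)))" using y[of z] by (simp add: r)
    moreover have "veronese (s\<^sup>2 *s a) (s *s b) c v = (v $ 2)\<^sup>2 *s veronese a b c (pt (s * z))"
      using False by (simp add: z_def pt_def veronese_def vec_eq_iff power2_eq_square algebra_simps)
    ultimately show ?thesis using False nz pt_nz by (simp add: abs_proj_scale)
  qed
  ultimately show ?thesis by blast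
qed

end

section \<open>Stationary bisecants and the edge curve\<close>

text \<open>Two independent common zeros \<open>u, v\<close> are found by counting linear conditions. Together with vectors
  dual to the two forms they are a basis of the whole space, in which the line is read off.\<close>

lemma line_of_two_planes:
  fixes h\<^sub>1 h\<^sub>2 :: "complex ^ 4 \<Rightarrow> complex"
  assumes h\<^sub>1: "form 1 h\<^sub>1" and h\<^sub>2: "form 1 h\<^sub>2"
    and e: "h\<^sub>1 e\<^sub>1 \<noteq> 0" "h\<^sub>2 e\<^sub>1 = 0" "h\<^sub>1 e\<^sub>2 = 0" "h\<^sub>2 e\<^sub>2 \<noteq> 0"
  shows "\<exists>u v. (\<forall>\<kappa> \<mu>. \<kappa> *s u + \<mu> *s v = 0 \<longrightarrow> \<kappa> = 0 \<and> \<mu> = 0) \<and>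
    (\<forall>x. h\<^sub>1 x = 0 \<and> h\<^sub>2 x = 0 \<longleftrightarrow> (\<exists>\<kappa> \<mu>. x = \<kappa> *s u + \<mu> *s v))"
proof -
  obtain u where u: "u \<noteq> 0" "h\<^sub>1 u = 0" "h\<^sub>2 u = 0"
    using three_linear_forms_common_zero[OF h\<^sub>1 h\<^sub>2 h\<^sub>2] by blast
  then obtain i where i: "u $ i \<noteq> 0" by (auto simp: vec_eq_iff)
  obtain v where v: "v \<noteq> 0" "h\<^sub>1 v = 0" "h\<^sub>2 v = 0" "v $ i = 0"
    using three_linear_forms_common_zero[OF h\<^sub>1 h\<^sub>2 form_component] by blast
  have indep: "\<kappa> = 0 \<and> \<mu> = 0" if 0: "\<kappa> *s u + \<mu> *s v = 0" for \<kappa> \<mu>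
  proof -
    have "(\<kappa> *s u + \<mu> *s v) $ i = 0" unfolding 0 by simp
    then have "\<kappa> = 0" using i v by simp
    with 0 v(1) show ?thesis by simp
  qed
  note lin = form_1_linear[OF h\<^sub>1] form_1_linear[OF h\<^sub>2]
  have span: "\<exists>\<kappa> \<mu>. x = \<kappa> *s u + \<mu> *s v" if x: "h\<^sub>1 x = 0" "h\<^sub>2 x = 0" for x
  proof -
    have "\<exists>\<alpha> \<beta> \<gamma> \<delta>. x = \<alpha> *s u + \<beta> *s v + \<gamma> *s e\<^sub>1 + \<delta> *s e\<^sub>2"
    proof (rule four_independent_vectors_span)
      fix \<alpha> \<beta> \<gamma> \<delta> assume 0: "\<alpha> *s u + \<beta> *s v + \<gamma> *s e\<^sub>1 + \<delta> *s e\<^sub>2 = 0"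
      have "h\<^sub>1 (\<alpha> *s u + \<beta> *s v + \<gamma> *s e\<^sub>1 + \<delta> *s e\<^sub>2) = 0"
        "h\<^sub>2 (\<alpha> *s u + \<beta> *s v + \<gamma> *s e\<^sub>1 + \<delta> *s e\<^sub>2) = 0"
        unfolding 0 by (simp_all add: lin)
      then have "\<gamma> = 0" "\<delta> = 0" using u v e by (simp_all add: lin)
      with 0 indep[of \<alpha> \<beta>] show "\<alpha> = 0 \<and> \<beta> = 0 \<and> \<gamma> = 0 \<and> \<delta> = 0" by simp
    qed
    then obtain \<alpha> \<beta> \<gamma> \<delta> where eq: "x = \<alpha> *s u + \<beta> *s v + \<gamma> *s e\<^sub>1 + \<delta> *s e\<^sub>2" by blast
    have "\<gamma> = 0" "\<delta> = 0" using x u v e unfolding eq by (simp_all add: lin)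
    with eq show ?thesis by auto
  qed
  show ?thesis
    by (intro exI[of _ u] exI[of _ v]) (use indep span u v in \<open>auto simp: lin\<close>)
qed

text \<open>The root \<open>t\<close> of smaller absolute value: for roots \<open>t, t'\<close> the constant coefficient is \<open>c\<^sub>2 t t'\<close>
  and the linear one is \<open>- c\<^sub>2 (t + t')\<close>. The two bounds make \<open>t\<close> small together with \<open>c\<^sub>0\<close> as long as one of
  \<open>c\<^sub>1, c\<^sub>2\<close> stays away from zero.\<close>

lemma small_root_of_quadratic:
  fixes c\<^sub>0 c\<^sub>1 c\<^sub>2 :: complex
  assumes "c\<^sub>1 \<noteq> 0 \<or> c\<^sub>2 \<noteq> 0"
  shows "\<exists>t. c\<^sub>0 + t * c\<^sub>1 + t * t * c\<^sub>2 = 0 \<and> (cmod t)\<^sup>2 * cmod c\<^sub>2 \<le> cmod c\<^sub>0 \<and>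
    cmod t * cmod c\<^sub>1 \<le> 2 * cmod c\<^sub>0"
proof (cases "c\<^sub>2 = 0")
  case True
  with assms show ?thesis
    by (intro exI[of _ "- c\<^sub>0 / c\<^sub>1"]) (simp add: norm_divide)
next
  case False
  define s where "s = csqrt (c\<^sub>1\<^sup>2 - 4 * c\<^sub>2 * c\<^sub>0)"
  define r\<^sub>1 where "r\<^sub>1 = (- c\<^sub>1 + s) / (2 * c\<^sub>2)"
  define r\<^sub>2 where "r\<^sub>2 = (- c\<^sub>1 - s) / (2 * c\<^sub>2)"
  have s: "s * s = c\<^sub>1\<^sup>2 - 4 * c\<^sub>2 * c\<^sub>0"
    using power2_csqrt[of "c\<^sub>1\<^sup>2 - 4 * c\<^sub>2 * c\<^sub>0"] unfolding s_def power2_eq_square by simp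
  have sum: "c\<^sub>1 = - c\<^sub>2 * (r\<^sub>1 + r\<^sub>2)" using False by (simp add: r\<^sub>1_def r\<^sub>2_def field_simps)
  have "r\<^sub>1 * r\<^sub>2 = (c\<^sub>1 * c\<^sub>1 - s * s) / (4 * c\<^sub>2 * c\<^sub>2)"
    by (simp add: r\<^sub>1_def r\<^sub>2_def algebra_simps)
  then have prod: "c\<^sub>0 = c\<^sub>2 * (r\<^sub>1 * r\<^sub>2)" using False by (simp add: s power2_eq_square)
  have *: "c\<^sub>0 + t * c\<^sub>1 + t * t * c\<^sub>2 = 0 \<and> (cmod t)\<^sup>2 * cmod c\<^sub>2 \<le> cmod c\<^sub>0 \<and>
      cmod t * cmod c\<^sub>1 \<le> 2 * cmod c\<^sub>0"
    if c: "c\<^sub>0 = c\<^sub>2 * (t * t')" "c\<^sub>1 = - c\<^sub>2 * (t + t')" and le: "cmod t \<le> cmod t'" for t t'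
  proof (intro conjI)
    show "c\<^sub>0 + t * c\<^sub>1 + t * t * c\<^sub>2 = 0" unfolding c by (simp add: algebra_simps)
    have "cmod c\<^sub>2 * (cmod t * cmod t) \<le> cmod c\<^sub>2 * (cmod t * cmod t')"
      using le by (intro mult_left_mono) auto
    then show "(cmod t)\<^sup>2 * cmod c\<^sub>2 \<le> cmod c\<^sub>0"
      unfolding c(1) norm_mult power2_eq_square by (simp only: mult_ac)
    have "cmod (t + t') \<le> 2 * cmod t'" using norm_triangle_ineq[of t t'] le by simp
    then have "cmod t * cmod c\<^sub>2 * cmod (t + t') \<le> cmod t * cmod c\<^sub>2 * (2 * cmod t')"
      by (intro mult_left_mono) auto
    then show "cmod t * cmod c\<^sub>1 \<le> 2 * cmod c\<^sub>0"
      unfolding c norm_mult norm_minus_cancel by (simp add: mult_ac)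
  qed
  show ?thesis
  proof (cases "cmod r\<^sub>1 \<le> cmod r\<^sub>2")
    case True
    with *[OF prod sum] show ?thesis by blast
  next
    case False
    then have "cmod r\<^sub>2 \<le> cmod r\<^sub>1" by simp
    with *[of r\<^sub>2 r\<^sub>1] prod sum show ?thesis
      unfolding mult.commute[of r\<^sub>2 r\<^sub>1] add.commute[of r\<^sub>2 r\<^sub>1] by blast
  qed
qed

lemma continuous_root_of_quadratic:
  fixes c\<^sub>0 c\<^sub>1 c\<^sub>2 :: "complex \<Rightarrow> complex"
  assumes lim: "(c\<^sub>0 \<longlongrightarrow> 0) (at a)" "(c\<^sub>1 \<longlongrightarrow> l\<^sub>1) (at a)" "(c\<^sub>2 \<longlongrightarrow> l\<^sub>2) (at a)"
    and nz: "l\<^sub>1 \<noteq> 0 \<or> l\<^sub>2 \<noteq> 0"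
  shows "\<exists>\<tau>. (\<tau> \<longlongrightarrow> 0) (at a) \<and> (\<forall>\<^sub>F s in at a. c\<^sub>0 s + \<tau> s * c\<^sub>1 s + \<tau> s * \<tau> s * c\<^sub>2 s = 0)"
proof -
  define good where "good s t \<longleftrightarrow> c\<^sub>0 s + t * c\<^sub>1 s + t * t * c\<^sub>2 s = 0 \<and>
    (cmod t)\<^sup>2 * cmod (c\<^sub>2 s) \<le> cmod (c\<^sub>0 s) \<and> cmod t * cmod (c\<^sub>1 s) \<le> 2 * cmod (c\<^sub>0 s)" for s t
  define \<tau> where "\<tau> s = (SOME t. good s t)" for s
  have good: "good s (\<tau> s)" if "c\<^sub>1 s \<noteq> 0 \<or> c\<^sub>2 s \<noteq> 0" for s
    unfolding \<tau>_def
    by (rule someI_ex) (use small_root_of_quadratic[OF that, of "c\<^sub>0 s"] in \<open>unfold good_def\<close>)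
  have c0: "((\<lambda>s. cmod (c\<^sub>0 s)) \<longlongrightarrow> 0) (at a)" using lim(1) by (rule tendsto_norm_zero)
  show ?thesis
  proof (cases "l\<^sub>1 = 0")
    case False
    then have ev: "\<forall>\<^sub>F s in at a. c\<^sub>1 s \<noteq> 0" using lim(2) tendsto_imp_eventually_ne by blast
    have "((\<lambda>s. 2 * cmod (c\<^sub>0 s) / cmod (c\<^sub>1 s)) \<longlongrightarrow> 2 * 0 / cmod l\<^sub>1) (at a)"
      using False by (intro tendsto_intros c0 lim) auto
    then have "((\<lambda>s. 2 * cmod (c\<^sub>0 s) / cmod (c\<^sub>1 s)) \<longlongrightarrow> 0) (at a)" by simp
    then have "(\<tau> \<longlongrightarrow> 0) (at a)"
    proof (rule Lim_null_comparison[rotated])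
      show "\<forall>\<^sub>F s in at a. norm (\<tau> s) \<le> 2 * cmod (c\<^sub>0 s) / cmod (c\<^sub>1 s)"
        using ev by eventually_elim (use good in \<open>auto simp: good_def field_simps\<close>)
    qed
    moreover have "\<forall>\<^sub>F s in at a. c\<^sub>0 s + \<tau> s * c\<^sub>1 s + \<tau> s * \<tau> s * c\<^sub>2 s = 0"
      using ev by eventually_elim (use good in \<open>auto simp: good_def\<close>)
    ultimately show ?thesis by blast
  next
    case True
    with nz have l2: "l\<^sub>2 \<noteq> 0" by simp
    then have ev: "\<forall>\<^sub>F s in at a. c\<^sub>2 s \<noteq> 0" using lim(3) tendsto_imp_eventually_ne by blast
    have "((\<lambda>s. sqrt (cmod (c\<^sub>0 s) / cmod (c\<^sub>2 s))) \<longlongrightarrow> sqrt (0 / cmod l\<^sub>2)) (at a)"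
      using l2 by (intro tendsto_intros c0 lim) auto
    then have "((\<lambda>s. sqrt (cmod (c\<^sub>0 s) / cmod (c\<^sub>2 s))) \<longlongrightarrow> 0) (at a)" by simp
    then have "(\<tau> \<longlongrightarrow> 0) (at a)"
    proof (rule Lim_null_comparison[rotated])
      show "\<forall>\<^sub>F s in at a. norm (\<tau> s) \<le> sqrt (cmod (c\<^sub>0 s) / cmod (c\<^sub>2 s))"
        using ev by eventually_elim (use good in \<open>auto simp: good_def field_simps intro!: real_le_rsqrt\<close>)
    qed
    moreover have "\<forall>\<^sub>F s in at a. c\<^sub>0 s + \<tau> s * c\<^sub>1 s + \<tau> s * \<tau> s * c\<^sub>2 s = 0"
      using ev by eventually_elim (use good in \<open>auto simp: good_def\<close>)
    ultimately show ?thesis by blast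
  qed
qed

locale conic_pair =
  C1: plane_conic C\<^sub>1 h\<^sub>1 B\<^sub>1 + C2: plane_conic C\<^sub>2 h\<^sub>2 B\<^sub>2
  for C\<^sub>1 h\<^sub>1 B\<^sub>1 C\<^sub>2 h\<^sub>2 B\<^sub>2 +
  fixes u v :: "complex ^ 4"
  assumes planes: "\<exists>e. h\<^sub>1 e = 0 \<and> h\<^sub>2 e \<noteq> 0"
    and uv_independent: "\<kappa> *s u + \<mu> *s v = 0 \<Longrightarrow> \<kappa> = 0 \<and> \<mu> = 0"
    and line_eq: "h\<^sub>1 x = 0 \<and> h\<^sub>2 x = 0 \<longleftrightarrow> (\<exists>\<kappa> \<mu>. x = \<kappa> *s u + \<mu> *s v)"
begin

text \<open>The determinant of the restrictions of the linear forms \<open>B\<^sub>1 x\<close> and \<open>B\<^sub>2 y\<close> to the common line of the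
  planes.\<close>

definition tangency :: "complex ^ 4 \<Rightarrow> complex ^ 4 \<Rightarrow> complex" where
  "tangency x y = B\<^sub>1 x u * B\<^sub>2 y v - B\<^sub>1 x v * B\<^sub>2 y u"

lemma biform_tangency: "biform 1 1 tangency"
proof -
  have "form 1 (\<lambda>x. B\<^sub>1 x y)" "form 1 (\<lambda>x. B\<^sub>2 x y)" for y
    using C1.form_B[of y] C2.form_B[of y] by (simp_all add: C1.B_sym[of _ y] C2.B_sym[of _ y])
  then have "biform 1 1 (\<lambda>x y. B\<^sub>1 x u * B\<^sub>2 y v - B\<^sub>1 x v * B\<^sub>2 y u)"
    by (intro biform_diff biform_mult)
  then show ?thesis by (simp add: tangency_def[abs_def])
qed

lemma tangents_meet_iff:
  assumes p: "p \<in> C\<^sub>1" and q: "q \<in> C\<^sub>2"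
  shows "tangent_space C\<^sub>1 p \<inter> tangent_space C\<^sub>2 q \<noteq> {} \<longleftrightarrow> tangency (rep_proj p) (rep_proj q) = 0"
proof -
  define x y where "x = rep_proj p" and "y = rep_proj q"
  have "tangent_space C\<^sub>1 p \<inter> tangent_space C\<^sub>2 q \<noteq> {} \<longleftrightarrow>
      (\<exists>z. z \<noteq> 0 \<and> h\<^sub>1 z = 0 \<and> h\<^sub>2 z = 0 \<and> B\<^sub>1 x z = 0 \<and> B\<^sub>2 y z = 0)" (is "?L \<longleftrightarrow> ?R")
  proof
    assume ?L
    then obtain r where "r \<in> tangent_space C\<^sub>1 p" "r \<in> tangent_space C\<^sub>2 q" by blast
    then show ?R unfolding C1.tangent_space_conic[OF p] C2.tangent_space_conic[OF q] x_def y_def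
      using rep_proj_nonzero by blast
  next
    assume ?R
    then obtain z where z: "z \<noteq> 0" "h\<^sub>1 z = 0" "h\<^sub>2 z = 0" "B\<^sub>1 x z = 0" "B\<^sub>2 y z = 0" by blast
    obtain c where "rep_proj (abs_proj z) = c *s z" using rep_abs_proj[OF z(1)] by blast
    with z have "abs_proj z \<in> tangent_space C\<^sub>1 p \<inter> tangent_space C\<^sub>2 q"
      unfolding x_def y_def
      by (simp add: C1.tangent_space_conic[OF p] C2.tangent_space_conic[OF q]
          C1.h_linear C2.h_linear C1.B_linear C2.B_linear)
    then show ?L by blast
  qed
  also have "\<dots> \<longleftrightarrow> (\<exists>\<kappa> \<mu>. (\<kappa> \<noteq> 0 \<or> \<mu> \<noteq> 0) \<and>
      \<kappa> * B\<^sub>1 x u + \<mu> * B\<^sub>1 x v = 0 \<and> \<kappa> * B\<^sub>2 y u + \<mu> * B\<^sub>2 y v = 0)" (is "?L \<longleftrightarrow> ?R")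
  proof
    assume ?L
    then obtain z where z: "z \<noteq> 0" "h\<^sub>1 z = 0 \<and> h\<^sub>2 z = 0" "B\<^sub>1 x z = 0" "B\<^sub>2 y z = 0" by blast
    from z(2) obtain \<kappa> \<mu> where eq: "z = \<kappa> *s u + \<mu> *s v" unfolding line_eq by blast
    have "\<kappa> \<noteq> 0 \<or> \<mu> \<noteq> 0" using z(1) unfolding eq by auto
    moreover have "\<kappa> * B\<^sub>1 x u + \<mu> * B\<^sub>1 x v = 0" "\<kappa> * B\<^sub>2 y u + \<mu> * B\<^sub>2 y v = 0"
      using z(3,4) unfolding eq by (simp_all add: C1.B_linear C2.B_linear)
    ultimately show ?R by blast
  next
    assume ?R
    then obtain \<kappa> \<mu> where *: "\<kappa> \<noteq> 0 \<or> \<mu> \<noteq> 0"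
      "\<kappa> * B\<^sub>1 x u + \<mu> * B\<^sub>1 x v = 0" "\<kappa> * B\<^sub>2 y u + \<mu> * B\<^sub>2 y v = 0" by blast
    define z where "z = \<kappa> *s u + \<mu> *s v"
    have "z \<noteq> 0" using *(1) uv_independent unfolding z_def by blast
    moreover have "h\<^sub>1 z = 0 \<and> h\<^sub>2 z = 0" unfolding line_eq z_def by blast
    moreover have "B\<^sub>1 x z = 0" "B\<^sub>2 y z = 0"
      using *(2,3) by (simp_all add: z_def C1.B_linear C2.B_linear)
    ultimately show ?L by blast
  qed
  also have "\<dots> \<longleftrightarrow> tangency x y = 0"
  proof
    assume "\<exists>\<kappa> \<mu>. (\<kappa> \<noteq> 0 \<or> \<mu> \<noteq> 0) \<and>
      \<kappa> * B\<^sub>1 x u + \<mu> * B\<^sub>1 x v = 0 \<and> \<kappa> * B\<^sub>2 y u + \<mu> * B\<^sub>2 y v = 0"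
    then obtain \<kappa> \<mu> where *: "\<kappa> \<noteq> 0 \<or> \<mu> \<noteq> 0"
      "\<kappa> * B\<^sub>1 x u + \<mu> * B\<^sub>1 x v = 0" "\<kappa> * B\<^sub>2 y u + \<mu> * B\<^sub>2 y v = 0" by blast
    have "\<kappa> * tangency x y = (\<kappa> * B\<^sub>1 x u + \<mu> * B\<^sub>1 x v) * B\<^sub>2 y v - B\<^sub>1 x v * (\<kappa> * B\<^sub>2 y u + \<mu> * B\<^sub>2 y v)"
      "\<mu> * tangency x y = B\<^sub>1 x u * (\<kappa> * B\<^sub>2 y u + \<mu> * B\<^sub>2 y v) - (\<kappa> * B\<^sub>1 x u + \<mu> * B\<^sub>1 x v) * B\<^sub>2 y u"
      by (simp_all add: tangency_def algebra_simps)
    then have "\<kappa> * tangency x y = 0" "\<mu> * tangency x y = 0" unfolding *(2,3) by simp_all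
    with *(1) show "tangency x y = 0" by auto
  next
    assume tangency: "tangency x y = 0"
    consider "B\<^sub>1 x u \<noteq> 0 \<or> B\<^sub>1 x v \<noteq> 0" | "B\<^sub>2 y u \<noteq> 0 \<or> B\<^sub>2 y v \<noteq> 0"
      | "B\<^sub>1 x u = 0" "B\<^sub>1 x v = 0" "B\<^sub>2 y u = 0" "B\<^sub>2 y v = 0" by blast
    then show "\<exists>\<kappa> \<mu>. (\<kappa> \<noteq> 0 \<or> \<mu> \<noteq> 0) \<and>
      \<kappa> * B\<^sub>1 x u + \<mu> * B\<^sub>1 x v = 0 \<and> \<kappa> * B\<^sub>2 y u + \<mu> * B\<^sub>2 y v = 0"
    proof cases
      case 1
      with tangency show ?thesis
        by (intro exI[of _ "B\<^sub>1 x v"] exI[of _ "- B\<^sub>1 x u"]) (auto simp: tangency_def algebra_simps)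
    next
      case 2
      with tangency show ?thesis
        by (intro exI[of _ "B\<^sub>2 y v"] exI[of _ "- B\<^sub>2 y u"]) (auto simp: tangency_def algebra_simps)
    next
      case 3
      then show ?thesis by (intro exI[of _ 1] exI[of _ 0]) auto
    qed
  qed
  finally show ?thesis by (simp add: x_def y_def)
qed

lemma stationary_bisecant_iff:
  "stationary_bisecant C\<^sub>1 C\<^sub>2 p q \<longleftrightarrow> p \<in> C\<^sub>1 \<and> q \<in> C\<^sub>2 \<and> p \<noteq> q \<and> (p, q) \<in> bizeros tangency"
  using tangents_meet_iff[of p q] by (auto simp: stationary_bisecant_def bizeros_def)

text \<open>Parametrize both conics by frames with first vector \<open>p\<close>. The determinant is a quadratic polynomial in the
  parameter \<open>t\<close> of \<open>C\<^sub>2\<close>, with coefficients depending on the parameter \<open>s\<close> of \<open>C\<^sub>1\<close>, and zero at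
  \<open>s = t = 0\<close>. If at \<open>s = 0\<close> it is zero for all \<open>t\<close>, then the pairs of \<open>p\<close> and a point of \<open>C\<^sub>2\<close> tending to
  \<open>p\<close> are stationary bisecants. Otherwise it has a root \<open>\<tau>(s)\<close> that tends to zero with \<open>s\<close>. The points
  with parameters \<open>s\<close> and \<open>\<tau>(s)\<close> are distinct for small \<open>s \<noteq> 0\<close>, as the first one is not in the plane of
  \<open>C\<^sub>2\<close>. In both cases continuity gives the vanishing at \<open>(p, p)\<close>.\<close>

lemma biform_vanishes_at_common_point:
  assumes p: "p \<in> C\<^sub>1" "p \<in> C\<^sub>2" "(p, p) \<in> bizeros tangency"
    and G: "biform d e G" and vanish: "{(p, q). stationary_bisecant C\<^sub>1 C\<^sub>2 p q} \<subseteq> bizeros G"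
  shows "(p, p) \<in> bizeros G"
proof -
  obtain k b c where "C1.frame k (rep_proj p) b c" using C1.frame_through_point[OF p(1)] by blast
  moreover obtain k' b' c' where "C2.frame k' (rep_proj p) b' c'"
    using C2.frame_through_point[OF p(2)] by blast
  moreover define a where "a = rep_proj p"
  ultimately have F: "C1.frame k a b c" and F': "C2.frame k' a b' c'" by simp_all
  have tangency_aa: "tangency a a = 0" using p(3) by (simp add: a_def bizeros_def)
  define P where "P s = veronese a b c (vector [1, s])" for s
  define Q where "Q t = veronese a b' c' (vector [1, t])" for t
  have one_nz: "vector [1, s] \<noteq> (0 :: complex ^ 2)" for s by (simp add: vec_eq_iff forall_2)
  have P_nz: "P s \<noteq> 0" and Q_nz: "Q s \<noteq> 0" for s
    unfolding P_def Q_def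
    by (rule C1.frame_veronese_nonzero[OF F one_nz] C2.frame_veronese_nonzero[OF F' one_nz])+
  have P_C: "abs_proj (P s) \<in> C\<^sub>1" and Q_C: "abs_proj (Q s) \<in> C\<^sub>2" for s
    unfolding C1.abs_proj_in_conic[OF P_nz] C2.abs_proj_in_conic[OF Q_nz]
    by (simp_all add: P_def Q_def C1.frame_veronese[OF F] C2.frame_veronese[OF F'])
  have P_eq: "P s = a + s *s b + s\<^sup>2 *s c" and Q_eq: "Q s = a + s *s b' + s\<^sup>2 *s c'" for s
    by (simp_all add: P_def Q_def veronese_def)
  have G_zero: "G (P s) (Q t) = 0" if "tangency (P s) (Q t) = 0" "abs_proj (P s) \<noteq> abs_proj (Q t)" for s t
  proof -
    have "(abs_proj (P s), abs_proj (Q t)) \<in> bizeros tangency"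
      using that(1) bizeros_abs_proj[OF biform_tangency P_nz Q_nz] by simp
    then have "stationary_bisecant C\<^sub>1 C\<^sub>2 (abs_proj (P s)) (abs_proj (Q t))"
      using P_C Q_C that(2) by (simp add: stationary_bisecant_iff)
    then have "(abs_proj (P s), abs_proj (Q t)) \<in> bizeros G" using vanish by blast
    then show ?thesis using bizeros_abs_proj[OF G P_nz Q_nz] by simp
  qed
  have lim: "((\<lambda>s. G (P (f s)) (Q (g s))) \<longlongrightarrow> G a a) (at 0)"
    if "(f \<longlongrightarrow> 0) (at 0)" "(g \<longlongrightarrow> 0) (at 0)" for f g :: "complex \<Rightarrow> complex"
  proof (rule biform_tendsto[OF G])
    fix i
    have "((\<lambda>s. a $ i + f s * b $ i + (f s)\<^sup>2 * c $ i) \<longlongrightarrow> a $ i + 0 * b $ i + 0\<^sup>2 * c $ i) (at 0)"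
      "((\<lambda>s. a $ i + g s * b' $ i + (g s)\<^sup>2 * c' $ i) \<longlongrightarrow> a $ i + 0 * b' $ i + 0\<^sup>2 * c' $ i) (at 0)"
      by (intro tendsto_intros that)+
    then show "((\<lambda>s. P (f s) $ i) \<longlongrightarrow> a $ i) (at 0)" "((\<lambda>s. Q (g s) $ i) \<longlongrightarrow> a $ i) (at 0)"
      by (simp_all add: P_eq Q_eq)
  qed
  have tangency_Q: "tangency x (Q t) = tangency x a + t * tangency x b' + t * t * tangency x c'" for x t
    by (simp add: tangency_def Q_eq C2.B_linear power2_eq_square algebra_simps)
  have "G a a = 0"
  proof (cases "tangency a b' = 0 \<and> tangency a c' = 0")
    case True
    have "\<forall>\<^sub>F t in at 0. G (P 0) (Q t) = 0"
    proof (rule eventually_mono[OF eventually_neq_at_within])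
      fix t :: complex assume t: "t \<noteq> 0"
      show "G (P 0) (Q t) = 0"
      proof (rule G_zero)
        show "tangency (P 0) (Q t) = 0" unfolding tangency_Q using True tangency_aa by (simp add: P_eq)
        show "abs_proj (P 0) \<noteq> abs_proj (Q t)"
        proof
          assume "abs_proj (P 0) = abs_proj (Q t)"
          then obtain m where "Q t = m *s P 0" using abs_proj_eqD[OF _ P_nz Q_nz] by blast
          then have "B\<^sub>2 a (Q t) = m * B\<^sub>2 a a" by (simp add: P_eq C2.B_linear)
          then show False using t F' C2.frame_veronese(3)[OF F', of "vector [1, t]"]
            by (simp add: C2.frame_def Q_def)
        qed
      qed
    qed
    then have "((\<lambda>t. G (P 0) (Q t)) \<longlongrightarrow> 0) (at 0)" by (rule tendsto_eventually)
    moreover have "((\<lambda>t. G (P 0) (Q t)) \<longlongrightarrow> G a a) (at 0)"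
      using lim[of "\<lambda>_. 0" "\<lambda>t. t"] by simp
    ultimately show ?thesis using tendsto_unique trivial_limit_at by blast
  next
    case False
    have tangency_lim: "((\<lambda>s. tangency (P s) x) \<longlongrightarrow> tangency a x) (at 0)" for x
    proof -
      have "((\<lambda>s. tangency a x + s * tangency b x + s\<^sup>2 * tangency c x) \<longlongrightarrow> tangency a x + 0 * tangency b x + 0\<^sup>2 * tangency c x) (at 0)"
        by (intro tendsto_intros)
      then show ?thesis by (simp add: tangency_def P_eq C1.B_linear algebra_simps)
    qed
    obtain \<tau> where \<tau>: "(\<tau> \<longlongrightarrow> 0) (at 0)"
      "\<forall>\<^sub>F s in at 0. tangency (P s) a + \<tau> s * tangency (P s) b' + \<tau> s * \<tau> s * tangency (P s) c' = 0"
      using continuous_root_of_quadratic[of "\<lambda>s. tangency (P s) a" 0 "\<lambda>s. tangency (P s) b'" "tangency a b'" "\<lambda>s. tangency (P s) c'" "tangency a c'"]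
        tangency_lim[of a] tangency_lim[of b'] tangency_lim[of c'] False tangency_aa by auto
    have "h\<^sub>2 b \<noteq> 0 \<or> h\<^sub>2 c \<noteq> 0"
    proof (rule ccontr)
      assume neg: "\<not> (h\<^sub>2 b \<noteq> 0 \<or> h\<^sub>2 c \<noteq> 0)"
      obtain z where z: "h\<^sub>1 z = 0" "h\<^sub>2 z \<noteq> 0" using planes by blast
      obtain \<alpha> \<beta> \<gamma> where "z = \<alpha> *s a + \<beta> *s b + \<gamma> *s c" using C1.frame_expansion[OF F z(1)] by blast
      then have "h\<^sub>2 z = 0" using neg F' by (simp add: C2.h_linear C2.frame_def)
      with z show False by simp
    qed
    then have "finite {s. poly [:0, h\<^sub>2 b, h\<^sub>2 c:] s = 0}" by (intro poly_roots_finite) auto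
    then have "\<forall>\<^sub>F s in at 0. \<forall>x\<in>{s. poly [:0, h\<^sub>2 b, h\<^sub>2 c:] s = 0}. s \<noteq> x"
      by (rule eventually_ball_finite) (auto intro: eventually_neq_at_within)
    then have ev: "\<forall>\<^sub>F s in at 0. h\<^sub>2 (P s) \<noteq> 0"
    proof eventually_elim
      case (elim s)
      then have "s * (h\<^sub>2 b + s * h\<^sub>2 c) \<noteq> 0" by auto
      then show ?case using F' by (simp add: P_eq C2.h_linear C2.frame_def algebra_simps power2_eq_square)
    qed
    have "\<forall>\<^sub>F s in at 0. G (P s) (Q (\<tau> s)) = 0"
      using ev \<tau>(2)
    proof eventually_elim
      case (elim s)
      have "abs_proj (P s) \<notin> C\<^sub>2" using elim(1) by (simp add: C2.abs_proj_in_conic[OF P_nz])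
      then have "abs_proj (P s) \<noteq> abs_proj (Q (\<tau> s))" using Q_C by metis
      then show ?case using elim(2) by (intro G_zero) (simp_all add: tangency_Q)
    qed
    then have "((\<lambda>s. G (P s) (Q (\<tau> s))) \<longlongrightarrow> 0) (at 0)" by (rule tendsto_eventually)
    moreover have "((\<lambda>s. G (P s) (Q (\<tau> s))) \<longlongrightarrow> G a a) (at 0)"
      using lim[of "\<lambda>s. s" \<tau>] \<tau>(1) by simp
    ultimately show ?thesis using tendsto_unique trivial_limit_at by blast
  qed
  then show ?thesis by (simp add: bizeros_def a_def)
qed

lemma edge_curve_eq: "edge_curve C\<^sub>1 C\<^sub>2 = (C\<^sub>1 \<times> C\<^sub>2) \<inter> bizeros tangency"
proof -
  have "{(p, q). stationary_bisecant C\<^sub>1 C\<^sub>2 p q} \<subseteq> bizeros tangency"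
    by (auto simp: stationary_bisecant_iff)
  then have "zariski_closure {(p, q). stationary_bisecant C\<^sub>1 C\<^sub>2 p q} \<subseteq> bizeros tangency"
    unfolding zariski_closure_def using biform_tangency by blast
  moreover have "(p, q) \<in> zariski_closure {(p, q). stationary_bisecant C\<^sub>1 C\<^sub>2 p q}"
    if pq: "p \<in> C\<^sub>1" "q \<in> C\<^sub>2" "(p, q) \<in> bizeros tangency" for p q
  proof (cases "p = q")
    case True
    with pq show ?thesis
      unfolding zariski_closure_def using biform_vanishes_at_common_point by blast
  next
    case False
    with pq have "stationary_bisecant C\<^sub>1 C\<^sub>2 p q" by (simp add: stationary_bisecant_iff)
    then show ?thesis unfolding zariski_closure_def by blast
  qed
  ultimately show ?thesis unfolding edge_curve_def by auto
qed

end

section \<open>Pencils of binary quadratic forms\<close>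

definition quadratic :: "complex ^ 3 \<Rightarrow> complex ^ 2 \<Rightarrow> complex" where
  "quadratic a w = a $ 1 * (w $ 1)\<^sup>2 + a $ 2 * (w $ 1 * w $ 2) + a $ 3 * (w $ 2)\<^sup>2"

definition discriminant :: "complex ^ 3 \<Rightarrow> complex" where
  "discriminant a = (a $ 2)\<^sup>2 - 4 * a $ 1 * a $ 3"

definition independent_pair :: "complex ^ 3 \<Rightarrow> complex ^ 3 \<Rightarrow> bool" where
  "independent_pair a b \<longleftrightarrow> (\<forall>\<kappa> \<mu>. \<kappa> *s a + \<mu> *s b = 0 \<longrightarrow> \<kappa> = 0 \<and> \<mu> = 0)"

lemma quadratic_combination: "quadratic (x *s a + y *s b) w = x * quadratic a w + y * quadratic b w"
  by (simp add: quadratic_def algebra_simps)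

text \<open>Over the complex numbers a binary quadratic form is a product of two linear forms. This is used
  both for quadratic forms on the line and for the discriminant of a pencil as a quadratic form
  in the parameters of the pencil.\<close>

lemma quadratic_factors:
  fixes a :: "complex ^ 3"
  assumes "a \<noteq> 0"
  shows "\<exists>l m l' m'. (l \<noteq> 0 \<or> m \<noteq> 0) \<and> (l' \<noteq> 0 \<or> m' \<noteq> 0) \<and>
    a $ 1 = l * l' \<and> a $ 2 = l * m' + m * l' \<and> a $ 3 = m * m'"
proof (cases "a $ 1 = 0")
  case True
  then have "a $ 2 \<noteq> 0 \<or> a $ 3 \<noteq> 0" using assms by (auto simp: vec_eq_iff forall_3)
  with True show ?thesis
    by (intro exI[of _ 0] exI[of _ 1] exI[of _ "a $ 2"] exI[of _ "a $ 3"]) simp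
next
  case False
  define s where "s = csqrt (discriminant a)"
  have s: "s * s = a $ 2 * a $ 2 - 4 * a $ 1 * a $ 3"
    using power2_csqrt[of "discriminant a"] unfolding s_def discriminant_def power2_eq_square by simp
  have "(a $ 2 + s) / 2 * ((a $ 2 - s) / (2 * a $ 1)) = (a $ 2 * a $ 2 - s * s) / (4 * a $ 1)"
    by (simp add: algebra_simps)
  also have "\<dots> = a $ 3" using False by (simp add: s)
  finally have "a $ 3 = (a $ 2 + s) / 2 * ((a $ 2 - s) / (2 * a $ 1))" ..
  moreover have "a $ 2 = a $ 1 * ((a $ 2 - s) / (2 * a $ 1)) + (a $ 2 + s) / 2 * 1"
    using False by (simp add: field_simps)
  ultimately show ?thesis using False
    by (intro exI[of _ "a $ 1"] exI[of _ "(a $ 2 + s) / 2"] exI[of _ 1]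
        exI[of _ "(a $ 2 - s) / (2 * a $ 1)"]) simp
qed

lemma linear_form_zero_on_line:
  fixes p :: "2 proj"
  assumes "l \<noteq> 0 \<or> m \<noteq> 0"
  shows "l * rep_proj p $ 1 + m * rep_proj p $ 2 = 0 \<longleftrightarrow> p = abs_proj (vector [m, - l])"
proof
  have nz: "vector [m, - l] \<noteq> (0 :: complex ^ 2)" using assms by (auto simp: vec_eq_iff forall_2)
  {
    assume 0: "l * rep_proj p $ 1 + m * rep_proj p $ 2 = 0"
    define c where "c = (if m = 0 then - rep_proj p $ 2 / l else rep_proj p $ 1 / m)"
    have eq: "rep_proj p = c *s vector [m, - l]"
      using 0 assms by (auto simp: c_def vec_eq_iff forall_2 field_simps add_eq_0_iff)
    then have "c \<noteq> 0" using rep_proj_nonzero[of p] by auto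
    then show "p = abs_proj (vector [m, - l])" using eq abs_proj_scale[OF nz] by (metis abs_rep_proj)
  next
    assume "p = abs_proj (vector [m, - l])"
    then obtain c where "rep_proj p = c *s vector [m, - l]" using rep_abs_proj[OF nz] by blast
    then show "l * rep_proj p $ 1 + m * rep_proj p $ 2 = 0" by simp
  }
qed

lemma quadratic_zeros:
  assumes "a \<noteq> 0"
  shows "finite {p. quadratic a (rep_proj p) = 0}"
    and "discriminant a \<noteq> 0 \<Longrightarrow> card {p. quadratic a (rep_proj p) = 0} = 2"
proof -
  obtain l m l' m' where nz: "l \<noteq> 0 \<or> m \<noteq> 0" "l' \<noteq> 0 \<or> m' \<noteq> 0"
    and eq: "a $ 1 = l * l'" "a $ 2 = l * m' + m * l'" "a $ 3 = m * m'"
    using quadratic_factors[OF assms] by blast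
  have "quadratic a w = (l * w $ 1 + m * w $ 2) * (l' * w $ 1 + m' * w $ 2)" for w
    by (simp add: quadratic_def eq power2_eq_square algebra_simps)
  then have zeros: "{p. quadratic a (rep_proj p) = 0} = {abs_proj (vector [m, - l]), abs_proj (vector [m', - l'])}"
    using linear_form_zero_on_line[OF nz(1)] linear_form_zero_on_line[OF nz(2)] by auto
  then show "finite {p. quadratic a (rep_proj p) = 0}" by simp
  assume disc: "discriminant a \<noteq> 0"
  have "discriminant a = (l * m' - m * l')\<^sup>2"
    by (simp add: discriminant_def eq power2_eq_square algebra_simps)
  then have "l * m' - m * l' \<noteq> 0" using disc by auto
  moreover have "l * m' - m * l' = 0" if "abs_proj (vector [m, - l]) = (abs_proj (vector [m', - l']) :: 2 proj)"
  proof -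
    have "vector [m, - l] \<noteq> (0 :: complex ^ 2)" "vector [m', - l'] \<noteq> (0 :: complex ^ 2)"
      using nz by (auto simp: vec_eq_iff forall_2)
    from abs_proj_eqD[OF that this] obtain c where "vector [m', - l'] = (c *s vector [m, - l] :: complex ^ 2)"
      by blast
    then have "m' = c * m" "l' = c * l" by (auto simp: vec_eq_iff forall_2)
    then show ?thesis by simp
  qed
  ultimately show "card {p. quadratic a (rep_proj p) = 0} = 2"
    unfolding zeros by (subst card_2_iff) blast
qed

text \<open>The discriminant is a quadratic form on the three-dimensional space of binary quadratic forms, and
  it is nondegenerate, so it does not vanish on a two-dimensional subspace. In coordinates, if
  it and its polarization are zero on \<open>a\<close> and \<open>b\<close>, then the squares of the minors of the pair are zero.\<close>

lemma pencil_discriminant: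
  assumes "independent_pair a b"
  shows "\<exists>d :: complex ^ 3. d \<noteq> 0 \<and> (\<forall>x y. discriminant (x *s a + y *s b) = d $ 1 * x\<^sup>2 + d $ 2 * (x * y) + d $ 3 * y\<^sup>2)"
proof -
  define e where "e = 2 * a $ 2 * b $ 2 - 4 * a $ 1 * b $ 3 - 4 * a $ 3 * b $ 1"
  have e_half: "a $ 2 * b $ 2 = e / 2 + 2 * (a $ 1 * b $ 3 + a $ 3 * b $ 1)"
    by (simp add: e_def field_simps)
  define d :: "complex ^ 3" where "d = vector [discriminant a, e, discriminant b]"
  have "d \<noteq> 0"
  proof
    assume "d = 0"
    then have "discriminant a = 0" "e = 0" "discriminant b = 0"
      by (simp_all add: d_def vec_eq_iff forall_3)
    then have *: "a $ 2 * a $ 2 = 4 * (a $ 1 * a $ 3)" "b $ 2 * b $ 2 = 4 * (b $ 1 * b $ 3)"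
      "a $ 2 * b $ 2 = 2 * (a $ 1 * b $ 3 + a $ 3 * b $ 1)"
      using e_half by (simp_all add: discriminant_def power2_eq_square)
    have "(a $ 1 * b $ 2 - a $ 2 * b $ 1)\<^sup>2 = 0"
    proof -
      have "(a $ 1 * b $ 2 - a $ 2 * b $ 1)\<^sup>2 = a $ 1 * a $ 1 * (b $ 2 * b $ 2)
          - 2 * (a $ 1 * b $ 1) * (a $ 2 * b $ 2) + b $ 1 * b $ 1 * (a $ 2 * a $ 2)"
        by (simp add: power2_eq_square algebra_simps)
      then show ?thesis unfolding * by (simp add: algebra_simps)
    qed
    moreover have "(a $ 3 * b $ 2 - a $ 2 * b $ 3)\<^sup>2 = 0"
    proof -
      have "(a $ 3 * b $ 2 - a $ 2 * b $ 3)\<^sup>2 = a $ 3 * a $ 3 * (b $ 2 * b $ 2)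
          - 2 * (a $ 3 * b $ 3) * (a $ 2 * b $ 2) + b $ 3 * b $ 3 * (a $ 2 * a $ 2)"
        by (simp add: power2_eq_square algebra_simps)
      then show ?thesis unfolding * by (simp add: algebra_simps)
    qed
    moreover have "(a $ 1 * b $ 3 - a $ 3 * b $ 1)\<^sup>2 = 0"
    proof -
      have "(a $ 2 * b $ 2) * (a $ 2 * b $ 2) = (a $ 2 * a $ 2) * (b $ 2 * b $ 2)" by simp
      then have "4 * (a $ 1 * b $ 3 - a $ 3 * b $ 1)\<^sup>2 = 0"
        unfolding * by (simp add: power2_eq_square algebra_simps)
      then show ?thesis by simp
    qed
    ultimately have minors: "a $ 1 * b $ 2 = a $ 2 * b $ 1" "a $ 3 * b $ 2 = a $ 2 * b $ 3"
      "a $ 1 * b $ 3 = a $ 3 * b $ 1" by simp_all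
    have "(b $ i) *s a + (- a $ i) *s b = 0" for i
      using minors exhaust_3[of i] by (auto simp: vec_eq_iff forall_3 mult.commute)
    then have "b $ i = 0 \<and> - a $ i = 0" for i
      using assms unfolding independent_pair_def by blast
    then have "1 *s a + 0 *s b = 0" by (simp add: vec_eq_iff)
    then show False using assms unfolding independent_pair_def by (metis zero_neq_one)
  qed
  moreover have "discriminant (x *s a + y *s b) = d $ 1 * x\<^sup>2 + d $ 2 * (x * y) + d $ 3 * y\<^sup>2" for x y
    by (simp add: d_def e_def discriminant_def power2_eq_square algebra_simps)
  ultimately show ?thesis by blast
qed

text \<open>For fixed \<open>q\<close> the form is the member of the pencil of \<open>a\<close> and \<open>b\<close> with parameters
  \<open>(b'(q), - a'(q))\<close>. Its discriminant is a product of two linear forms in these parameters, each of which is a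
  nonzero quadratic form in \<open>q\<close> by the independence of \<open>a'\<close> and \<open>b'\<close> and so has finitely many zeros.\<close>

lemma general_fibre_two_points:
  assumes ab: "independent_pair a b" and ab': "independent_pair a' b'"
  shows "\<forall>\<^sub>\<infinity>q. card {p. quadratic a (rep_proj p) * quadratic b' (rep_proj q)
    - quadratic b (rep_proj p) * quadratic a' (rep_proj q) = 0} = 2"
proof -
  obtain d :: "complex ^ 3" where d: "d \<noteq> 0"
    and disc: "\<And>x y. discriminant (x *s a + y *s b) = d $ 1 * x\<^sup>2 + d $ 2 * (x * y) + d $ 3 * y\<^sup>2"
    using pencil_discriminant[OF ab] by blast
  obtain l m l' m' where nz: "l \<noteq> 0 \<or> m \<noteq> 0" "l' \<noteq> 0 \<or> m' \<noteq> 0"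
    and eq: "d $ 1 = l * l'" "d $ 2 = l * m' + m * l'" "d $ 3 = m * m'"
    using quadratic_factors[OF d] by blast
  define g where "g l m = l *s b' + (- m) *s a'" for l m
  have g_nz: "g l m \<noteq> 0" if "l \<noteq> 0 \<or> m \<noteq> 0" for l m
  proof
    assume "g l m = 0"
    then have "(- m) *s a' + l *s b' = 0" by (simp add: g_def add.commute)
    then have "- m = 0 \<and> l = 0" using ab' unfolding independent_pair_def by blast
    with that show False by simp
  qed
  have "finite ({q. quadratic (g l m) (rep_proj q) = 0} \<union> {q. quadratic (g l' m') (rep_proj q) = 0})"
    using quadratic_zeros(1)[OF g_nz[OF nz(1)]] quadratic_zeros(1)[OF g_nz[OF nz(2)]] by simp
  moreover have "card {p. quadratic a (rep_proj p) * quadratic b' (rep_proj q)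
      - quadratic b (rep_proj p) * quadratic a' (rep_proj q) = 0} = 2"
    if q: "quadratic (g l m) (rep_proj q) \<noteq> 0" "quadratic (g l' m') (rep_proj q) \<noteq> 0" for q
  proof -
    define x y where "x = quadratic b' (rep_proj q)" and "y = - quadratic a' (rep_proj q)"
    have "discriminant (x *s a + y *s b) = (l * x + m * y) * (l' * x + m' * y)"
      by (simp add: disc eq power2_eq_square algebra_simps)
    also have "\<dots> = quadratic (g l m) (rep_proj q) * quadratic (g l' m') (rep_proj q)"
      unfolding g_def quadratic_combination x_def y_def by simp
    finally have disc_nz: "discriminant (x *s a + y *s b) \<noteq> 0" using q by simp
    moreover have "discriminant 0 = 0" by (simp add: discriminant_def)
    ultimately have "x *s a + y *s b \<noteq> 0" by metis
    from quadratic_zeros(2)[OF this disc_nz]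
    show ?thesis unfolding quadratic_combination by (simp add: x_def y_def mult.commute)
  qed
  ultimately show ?thesis
    unfolding eventually_cofinite by (elim finite_subset[rotated]) auto
qed

lemma infinite_projective_line: "infinite (UNIV :: 2 proj set)"
proof -
  have "inj (\<lambda>z. abs_proj (vector [z, 1]) :: 2 proj)"
  proof (rule injI)
    fix z w :: complex
    assume eq: "abs_proj (vector [z, 1]) = (abs_proj (vector [w, 1]) :: 2 proj)"
    have "vector [z, 1] \<noteq> (0 :: complex ^ 2)" "vector [w, 1] \<noteq> (0 :: complex ^ 2)"
      by (simp_all add: vec_eq_iff forall_2)
    from abs_proj_eqD[OF eq this] show "z = w" by (auto simp: vec_eq_iff forall_2)
  qed
  then show ?thesis using infinite_UNIV_char_0 finite_imageD[of _ UNIV]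
    by (metis finite_subset subset_UNIV)
qed

lemma has_bidegree_pencils:
  assumes E: "E = bizeros (\<lambda>x y. quadratic a x * quadratic b' y - quadratic b x * quadratic a' y)"
    and biform: "biform 2 2 (\<lambda>x y. quadratic a x * quadratic b' y - quadratic b x * quadratic a' y)"
    and ab: "independent_pair a b" and ab': "independent_pair a' b'"
  shows "has_bidegree E 2 2"
proof -
  have 1: "\<forall>\<^sub>\<infinity>q. card {p. (p, q) \<in> E} = 2"
    using general_fibre_two_points[OF ab ab'] by (simp add: E bizeros_def)
  have "{q. (p, q) \<in> E} = {q. quadratic a' (rep_proj q) * quadratic b (rep_proj p)
    - quadratic b' (rep_proj q) * quadratic a (rep_proj p) = 0}" for p
    by (auto simp: E bizeros_def mult.commute)
  then have 2: "\<forall>\<^sub>\<infinity>p. card {q. (p, q) \<in> E} = 2"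
    using general_fibre_two_points[OF ab' ab] by simp
  \<comment> \<open>If the form were zero, all fibres would be the whole line, which is infinite.\<close>
  obtain q where "card {p. (p, q) \<in> E} = 2"
    using 1 ex_new_if_finite[OF infinite_projective_line] unfolding eventually_cofinite by blast
  then have "{p. (p, q) \<in> E} \<noteq> UNIV" using infinite_projective_line by (metis card.infinite zero_neq_numeral)
  then have "\<exists>x y. quadratic a x * quadratic b' y - quadratic b x * quadratic a' y \<noteq> 0"
    by (auto simp: E bizeros_def)
  with 1 2 E biform show ?thesis unfolding has_bidegree_def by blast
qed

section \<open>The bidegree\<close>

text \<open>A linear relation between the two triples is a vector of the line that is orthogonal to the whole
  frame, hence zero.\<close>

lemma (in plane_conic) frame_independent_pair:
  assumes F: "frame k a b c" and h: "h u = 0" "h v = 0"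
    and uv: "\<And>\<kappa> \<mu>. \<kappa> *s u + \<mu> *s v = 0 \<Longrightarrow> \<kappa> = 0 \<and> \<mu> = 0"
  shows "independent_pair (vector [B a u, B b u, B c u]) (vector [B a v, B b v, B c v])"
  unfolding independent_pair_def
proof (intro allI impI)
  fix \<kappa> \<mu>
  assume "\<kappa> *s vector [B a u, B b u, B c u] + \<mu> *s vector [B a v, B b v, B c v] = (0 :: complex ^ 3)"
  then have *: "B a (\<kappa> *s u + \<mu> *s v) = 0" "B b (\<kappa> *s u + \<mu> *s v) = 0" "B c (\<kappa> *s u + \<mu> *s v) = 0"
    by (simp_all add: vec_eq_iff forall_3 B_linear)
  have "h (\<kappa> *s u + \<mu> *s v) = 0" using h by (simp add: h_linear)
  from frame_expansion[OF F this] have "\<kappa> *s u + \<mu> *s v = 0" unfolding * by simp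
  then show "\<kappa> = 0 \<and> \<mu> = 0" by (rule uv)
qed

lemma (in plane_conic) B_veronese:
  "B (veronese a b c w) u = quadratic (vector [B a u, B b u, B c u]) w"
  by (simp add: veronese_def quadratic_def B_linear mult.commute)

lemma (in conic_pair) edge_curve_bidegree:
  assumes \<phi>: "isomorphism UNIV C\<^sub>1 \<phi>" and \<psi>: "isomorphism UNIV C\<^sub>2 \<psi>"
  shows "has_bidegree {(x, y). (\<phi> x, \<psi> y) \<in> edge_curve C\<^sub>1 C\<^sub>2} 2 2"
proof -
  obtain k a b c where F: "C1.frame k a b c"
    and \<phi>_eq: "\<forall>w. w \<noteq> 0 \<longrightarrow> \<phi> (abs_proj w) = abs_proj (veronese a b c w)"
    using C1.isomorphism_veronese[OF \<phi>] by blast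
  obtain k' a' b' c' where F': "C2.frame k' a' b' c'"
    and \<psi>_eq: "\<forall>w. w \<noteq> 0 \<longrightarrow> \<psi> (abs_proj w) = abs_proj (veronese a' b' c' w)"
    using C2.isomorphism_veronese[OF \<psi>] by blast
  have tangency_eq: "tangency (veronese a b c x) (veronese a' b' c' y) =
      quadratic (vector [B\<^sub>1 a u, B\<^sub>1 b u, B\<^sub>1 c u]) x * quadratic (vector [B\<^sub>2 a' v, B\<^sub>2 b' v, B\<^sub>2 c' v]) y
    - quadratic (vector [B\<^sub>1 a v, B\<^sub>1 b v, B\<^sub>1 c v]) x * quadratic (vector [B\<^sub>2 a' u, B\<^sub>2 b' u, B\<^sub>2 c' u]) y" for x y
    by (simp add: tangency_def C1.B_veronese C2.B_veronese)
  have "(u = 1 *s u + 0 *s v)" "(v = 0 *s u + 1 *s v)" by simp_all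
  then have uv: "h\<^sub>1 u = 0 \<and> h\<^sub>2 u = 0" "h\<^sub>1 v = 0 \<and> h\<^sub>2 v = 0" unfolding line_eq by blast+
  have "(\<phi> x, \<psi> y) \<in> edge_curve C\<^sub>1 C\<^sub>2 \<longleftrightarrow>
      tangency (veronese a b c (rep_proj x)) (veronese a' b' c' (rep_proj y)) = 0" for x y
  proof -
    have "\<phi> x \<in> C\<^sub>1" "\<psi> y \<in> C\<^sub>2" using \<phi> \<psi> by (auto simp: isomorphism_def bij_betw_def)
    moreover have "\<phi> x = abs_proj (veronese a b c (rep_proj x))"
      "\<psi> y = abs_proj (veronese a' b' c' (rep_proj y))"
      using \<phi>_eq[rule_format, OF rep_proj_nonzero, of x] \<psi>_eq[rule_format, OF rep_proj_nonzero, of y]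
      by simp_all
    ultimately show ?thesis
      using bizeros_abs_proj[OF biform_tangency C1.frame_veronese_nonzero[OF F rep_proj_nonzero]
          C2.frame_veronese_nonzero[OF F' rep_proj_nonzero], of x y]
      by (simp add: edge_curve_eq)
  qed
  then have E: "{(x, y). (\<phi> x, \<psi> y) \<in> edge_curve C\<^sub>1 C\<^sub>2}
      = bizeros (\<lambda>x y. tangency (veronese a b c x) (veronese a' b' c' y))"
    by (simp add: bizeros_def)
  have "form 2 (\<lambda>x. B\<^sub>1 (veronese a b c x) z)" "form 2 (\<lambda>x. B\<^sub>2 (veronese a' b' c' x) z)" for z
    using form_linear_veronese[OF C1.form_B[of z], of a b c]
      form_linear_veronese[OF C2.form_B[of z], of a' b' c']
    by (simp_all add: C1.B_sym[of z] C2.B_sym[of z])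
  then have biform: "biform 2 2 (\<lambda>x y. tangency (veronese a b c x) (veronese a' b' c' y))"
    unfolding tangency_def by (intro biform_diff biform_mult)
  show ?thesis
  proof (rule has_bidegree_pencils[OF E[unfolded tangency_eq] biform[unfolded tangency_eq]])
    show "independent_pair (vector [B\<^sub>1 a u, B\<^sub>1 b u, B\<^sub>1 c u]) (vector [B\<^sub>1 a v, B\<^sub>1 b v, B\<^sub>1 c v])"
      by (rule C1.frame_independent_pair[OF F]) (use uv uv_independent in blast)+
    show "independent_pair (vector [B\<^sub>2 a' u, B\<^sub>2 b' u, B\<^sub>2 c' u]) (vector [B\<^sub>2 a' v, B\<^sub>2 b' v, B\<^sub>2 c' v])"
      by (rule C2.frame_independent_pair[OF F']) (use uv uv_independent in blast)+
  qed
qed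

lemma linear_form_kernel_not_contained:
  assumes f: "form 1 f" "\<exists>e. f e \<noteq> 0" and g: "form 1 g" "\<exists>e. g e \<noteq> 0"
    and "{x. f x = 0} \<noteq> {x. g x = 0}"
  shows "\<exists>x. f x = 0 \<and> g x \<noteq> 0"
proof (rule ccontr)
  assume "\<not> (\<exists>x. f x = 0 \<and> g x \<noteq> 0)"
  then have sub: "g x = 0" if "f x = 0" for x using that by blast
  obtain e where e: "f e \<noteq> 0" using f(2) by blast
  have g_eq: "g x = f x / f e * g e" for x
  proof -
    have "f (x - (f x / f e) *s e) = 0" using e by (simp add: form_1_linear[OF f(1)])
    then have "g (x - (f x / f e) *s e) = 0" by (rule sub)
    then show ?thesis by (simp add: form_1_linear[OF g(1)])
  qed
  have "g e \<noteq> 0"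
  proof
    assume "g e = 0"
    then have "g x = 0" for x using g_eq[of x] by simp
    with g(2) show False by blast
  qed
  then have "f x = 0 \<longleftrightarrow> g x = 0" for x using g_eq[of x] e by simp
  with assms(5) show False by simp
qed

theorem theorem3p3:
  fixes C\<^sub>1 C\<^sub>2 :: "4 proj set"
  assumes "smooth_conic C\<^sub>1" and "smooth_conic C\<^sub>2"
    and "linear_span C\<^sub>1 \<noteq> linear_span C\<^sub>2"
  shows "(\<exists>\<phi>. isomorphism (UNIV :: 2 proj set) C\<^sub>1 \<phi>) \<and>
    (\<exists>\<psi>. isomorphism (UNIV :: 2 proj set) C\<^sub>2 \<psi>) \<and>
    (\<forall>\<phi> \<psi>. isomorphism (UNIV :: 2 proj set) C\<^sub>1 \<phi> \<and> isomorphism (UNIV :: 2 proj set) C\<^sub>2 \<psi> \<longrightarrow>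
      has_bidegree {(x, y). (\<phi> x, \<psi> y) \<in> edge_curve C\<^sub>1 C\<^sub>2} 2 2)"
proof -
  obtain h\<^sub>1 B\<^sub>1 where "plane_conic C\<^sub>1 h\<^sub>1 B\<^sub>1" using smooth_conic_plane_conic[OF assms(1)] by blast
  then interpret C1: plane_conic C\<^sub>1 h\<^sub>1 B\<^sub>1 .
  obtain h\<^sub>2 B\<^sub>2 where "plane_conic C\<^sub>2 h\<^sub>2 B\<^sub>2" using smooth_conic_plane_conic[OF assms(2)] by blast
  then interpret C2: plane_conic C\<^sub>2 h\<^sub>2 B\<^sub>2 .
  have ne: "{x. h\<^sub>1 x = 0} \<noteq> {x. h\<^sub>2 x = 0}"
    using assms(3) by (simp add: C1.linear_span_conic C2.linear_span_conic)
  obtain e\<^sub>2 where e\<^sub>2: "h\<^sub>1 e\<^sub>2 = 0" "h\<^sub>2 e\<^sub>2 \<noteq> 0"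
    using linear_form_kernel_not_contained[OF C1.form_h C1.h_nonzero C2.form_h C2.h_nonzero ne] by blast
  obtain e\<^sub>1 where e\<^sub>1: "h\<^sub>2 e\<^sub>1 = 0" "h\<^sub>1 e\<^sub>1 \<noteq> 0"
    using linear_form_kernel_not_contained[OF C2.form_h C2.h_nonzero C1.form_h C1.h_nonzero ne[symmetric]]
    by blast
  obtain u v where uv: "\<forall>\<kappa> \<mu>. \<kappa> *s u + \<mu> *s v = 0 \<longrightarrow> \<kappa> = 0 \<and> \<mu> = 0"
    "\<forall>x. h\<^sub>1 x = 0 \<and> h\<^sub>2 x = 0 \<longleftrightarrow> (\<exists>\<kappa> \<mu>. x = \<kappa> *s u + \<mu> *s v)"
    using line_of_two_planes[OF C1.form_h C2.form_h e\<^sub>1(2,1) e\<^sub>2] by blast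
  interpret conic_pair C\<^sub>1 h\<^sub>1 B\<^sub>1 C\<^sub>2 h\<^sub>2 B\<^sub>2 u v
    by unfold_locales (use uv e\<^sub>2 in blast)+
  have "\<exists>\<phi>. isomorphism (UNIV :: 2 proj set) C\<^sub>1 \<phi>"
    using C1.frame_exists C1.frame_parametrization_isomorphism by blast
  moreover have "\<exists>\<psi>. isomorphism (UNIV :: 2 proj set) C\<^sub>2 \<psi>"
    using C2.frame_exists C2.frame_parametrization_isomorphism by blast
  ultimately show ?thesis using edge_curve_bidegree by blast
qed

end
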